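(* Let $(X_1,X_2)$ be a bivariate common-shock phase-type (CSPH) random vector with parameters $(\boldsymbol{\alpha},\mathbf{T},\mathbf{U},\mathbf{Q}_1,\mathbf{Q}_2,a_1,a_2)$, so that $X_i=a_i\tau_{1,2}+\tilde\tau_i$, $i=1,2$. Let $g(t,y_1,y_2)$ denote the trivariate probability density function of $(\tau_{1,2},\tilde\tau_1,\tilde\tau_2)$. Then, for $t,y_1,y_2\ge 0$, $$g(t,y_1,y_2)=\boldsymbol{\alpha}e^{\mathbf{T}t}\mathbf{P}\Bigl((e^{\mathbf{Q}_1y_1}\mathbf{q}_1)\otimes(e^{\mathbf{Q}_2y_2}\mathbf{q}_2)\Bigr),$$ where $\mathbf{q}_i=-\mathbf{Q}_i\mathbf{1}$, $\mathbf{u}^{(k)}=\mathbf{U}\mathbf{e}_k$, and $\mathbf{P}=\sum_{k\in\mathcal{S}}\mathbf{u}^{(k)}(\mathbf{e}_k^\top\otimes\mathbf{e}_k^\top)$. Moreover, let $f_{X_1,X_2}(z_1,z_2)$ be the bivariate probability density function of $(X_1,X_2)$, and write $z_1\curlywedge z_2=\min(z_1/a_1,z_2/a_2)$. For $z_1,z_2\ge 0$, this density is given by $$f_{X_1,X_2}(z_1,z_2)=\boldsymbol{\alpha}\,\mathbf{V}[\mathbf{T},\mathbf{P},(a_1\mathbf{Q}_1)\oplus(a_2\mathbf{Q}_2),z_1\curlywedge z_2]\,\Bigl(\mathbf{q}_1(z_1,z_2)\otimes\mathbf{q}_2(z_1,z_2)\Bigr),$$ where, for $i=1,2$, $\mathbf{q}_i(z_1,z_2)=e^{\mathbf{Q}_i(z_i-a_i(z_1\curlywedge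 z_2))}\mathbf{q}_i$.
   Context: CSPH distribution. Let $\mathcal{E}$ (pre-shock states) and $\mathcal{S}$ (post-shock states) be disjoint finite nonempty sets. The parameters are: a row probability vector $\boldsymbol{\alpha}$ on $\mathcal{E}$; a subintensity matrix $\mathbf{T}$ on $\mathcal{E}$; an entrywise nonnegative $|\mathcal{E}|\times|\mathcal{S}|$ matrix $\mathbf{U}$ with $\mathbf{T}\mathbf{1}+\mathbf{U}\mathbf{1}=\mathbf{0}$; subintensity matrices $\mathbf{Q}_1,\mathbf{Q}_2$ on $\mathcal{S}$; and scaling factors $a_1,a_2>0$. A subintensity matrix is a square real matrix with nonpositive diagonal entries, nonnegative off-diagonal entries and nonpositive row sums. All states of $\mathcal{E}$ are transient for $\mathbf{T}$ and all states of $\mathcal{S}$ are transient for $\mathbf{Q}_1$ and for $\mathbf{Q}_2$ (equivalently, $\mathbf{T},\mathbf{Q}_1,\mathbf{Q}_2$ are nonsingular), so all times below are almost surely finite. A continuous-time Markov jump process starts in $\mathcal{E}$ with initial distribution $\boldsymbol{\alpha}$, moves within $\mathcal{E}$ with rates $\mathbf{T}$ and jumps from $\mathcal{E}$ to $\mathcal{S}$ with rates $\mathbf{U}$. Let $\tau_{1,2}$ be the exit time from $\mathcal{E}$ (the common-shock time) and $K\in\mathcal{S}$ the state entered at that time. After $\tau_{1,2}$, two processes $J_1,J_2$ start from $K$ and evolve on $\mathcal{S}$ independently of each other (and, given $K$, of $\tau_{1,2}$), as Markov jump processes with subintensity matrices $\mathbf{Q}_1$ and $\mathbf{Q}_2$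 respectively, until absorption into a state outside $\mathcal{E}\cup\mathcal{S}$; $\tilde\tau_i$ is the time $J_i$ spends in $\mathcal{S}$. The vector $(X_1,X_2)$ with $X_i=a_i\tau_{1,2}+\tilde\tau_i$ is said to be CSPH distributed with parameters $(\boldsymbol{\alpha},\mathbf{T},\mathbf{U},\mathbf{Q}_1,\mathbf{Q}_2,a_1,a_2)$. Notation. $\mathbf{1}$ is a column vector of ones, $\mathbf{e}_k$ the $k$-th standard basis column vector of $\mathbb{R}^{\mathcal{S}}$, $\mathbf{I}$ an identity matrix and $\mathbf{0}$ a zero matrix/vector, of appropriate dimensions. $\otimes$ is the Kronecker product and $\mathbf{A}\oplus\mathbf{B}=\mathbf{A}\otimes\mathbf{I}+\mathbf{I}\otimes\mathbf{B}$ the Kronecker sum. For square $\mathbf{A},\mathbf{C}$ and $\mathbf{B}$ of compatible size, and $u\ge0$, $$\mathbf{V}[\mathbf{A},\mathbf{B},\mathbf{C},u]=\begin{pmatrix}\mathbf{I}&\mathbf{0}\end{pmatrix}\exp\left(\begin{pmatrix}\mathbf{A}&\mathbf{B}\\ \mathbf{0}&\mathbf{C}\end{pmatrix}u\right)\begin{pmatrix}\mathbf{0}\\ \mathbf{I}\end{pmatrix}.$$ *)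

theory Defs
  imports "HOL-Probability.Probability"
begin

section \<open>Matrices\<close>

text \<open>The library multiplication (and hence \<open>^\<close>) on the type \<open>real ^ 'n ^ 'n\<close> is
  componentwise, so powers are written as iterates of the matrix product \<open>**\<close>.\<close>

definition matrix_exp :: "real ^ 'n ^ 'n \<Rightarrow> real ^ 'n ^ 'n" where
  "matrix_exp A = (\<Sum>n. (1 / fact n) *\<^sub>R (((**) A) ^^ n) (mat 1))"

definition kron :: "real ^ 'n ^ 'm \<Rightarrow> real ^ 'q ^ 'p \<Rightarrow> real ^ ('n \<times> 'q) ^ ('m \<times> 'p)" where
  "kron A B = (\<chi> i j. A $ fst i $ fst j * B $ snd i $ snd j)"

text \<open>Kronecker product of two column vectors.  It is also used for two row vectors, the
  orientation being supplied afterwards by \<open>rowvector\<close>.\<close>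

definition kron_vec :: "real ^ 'm \<Rightarrow> real ^ 'p \<Rightarrow> real ^ ('m \<times> 'p)" where
  "kron_vec v w = (\<chi> i. v $ fst i * w $ snd i)"

definition kron_sum :: "real ^ 'm ^ 'm \<Rightarrow> real ^ 'p ^ 'p \<Rightarrow> real ^ ('m \<times> 'p) ^ ('m \<times> 'p)" where
  "kron_sum A B = kron A (mat 1) + kron (mat 1) B"

definition block_matrix ::
  "real ^ 'n ^ 'm \<Rightarrow> real ^ 'q ^ 'm \<Rightarrow> real ^ 'n ^ 'p \<Rightarrow> real ^ 'q ^ 'p \<Rightarrow> real ^ ('n + 'q) ^ ('m + 'p)"
where
  "block_matrix A B C D =
     (\<chi> i j. case i of
        Inl i' \<Rightarrow> (case j of Inl j' \<Rightarrow> A $ i' $ j' | Inr j' \<Rightarrow> B $ i' $ j')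
      | Inr i' \<Rightarrow> (case j of Inl j' \<Rightarrow> C $ i' $ j' | Inr j' \<Rightarrow> D $ i' $ j'))"

definition block_row :: "real ^ 'n ^ 'm \<Rightarrow> real ^ 'q ^ 'm \<Rightarrow> real ^ ('n + 'q) ^ 'm" where
  "block_row A B = (\<chi> i j. case j of Inl j' \<Rightarrow> A $ i $ j' | Inr j' \<Rightarrow> B $ i $ j')"

definition block_col :: "real ^ 'n ^ 'm \<Rightarrow> real ^ 'n ^ 'p \<Rightarrow> real ^ 'n ^ ('m + 'p)" where
  "block_col A B = (\<chi> i. case i of Inl i' \<Rightarrow> A $ i' | Inr i' \<Rightarrow> B $ i')"

definition V_block :: "real ^ 'm ^ 'm \<Rightarrow> real ^ 'p ^ 'm \<Rightarrow> real ^ 'p ^ 'p \<Rightarrow> real \<Rightarrow> real ^ 'p ^ 'm" where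
  "V_block A B C u =
     block_row (mat 1) 0 ** matrix_exp (u *\<^sub>R block_matrix A B 0 C) ** block_col 0 (mat 1)"


section \<open>Markov jump processes\<close>

definition transition_function :: "(real \<Rightarrow> real ^ 'x ^ 'x) \<Rightarrow> bool" where
  "transition_function P \<longleftrightarrow>
     (\<forall>t\<ge>0. \<forall>i j. 0 \<le> P t $ i $ j) \<and>
     (\<forall>t\<ge>0. \<forall>i. (\<Sum>j\<in>UNIV. P t $ i $ j) = 1) \<and>
     P 0 = mat 1 \<and>
     (\<forall>s\<ge>0. \<forall>t\<ge>0. P (s + t) = P s ** P t)"

text \<open>\<open>G\<close> is the intensity matrix, i.e. the matrix of jump rates: the one-sided derivative at 0 of
  the transition function.  The product formula for the finite-dimensional distributions expresses
  the initial distribution and the time-homogeneous Markov property.  Values of \<open>X\<close> at negative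
  times are irrelevant.\<close>

definition markov_jump_process ::
  "'w measure \<Rightarrow> real ^ 'x ^ 'x \<Rightarrow> real ^ 'x \<Rightarrow> (real \<Rightarrow> 'w \<Rightarrow> 'x::finite) \<Rightarrow> bool"
where
  "markov_jump_process M G \<pi> X \<longleftrightarrow>
     prob_space M \<and>
     (\<forall>t\<ge>0. X t \<in> measurable M (count_space UNIV)) \<and>
     (\<forall>\<omega>\<in>space M. \<forall>t\<ge>0. \<exists>\<epsilon>>0. \<forall>s\<in>{t..<t + \<epsilon>}. X s \<omega> = X t \<omega>) \<and>
     (\<exists>P. transition_function P \<and>
          (P has_vector_derivative G) (at 0 within {0..}) \<and>
          (\<forall>(n::nat) (t :: nat \<Rightarrow> real) (x :: nat \<Rightarrow> 'x).
             t 0 = 0 \<longrightarrow> (\<forall>k<n. t k \<le> t (Suc k)) \<longrightarrow>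
             measure M {\<omega>\<in>space M. \<forall>k\<le>n. X (t k) \<omega> = x k} =
               \<pi> $ x 0 * (\<Prod>k<n. P (t (Suc k) - t k) $ x k $ x (Suc k))))"

definition subintensity :: "real ^ 'n ^ 'n \<Rightarrow> bool" where
  "subintensity A \<longleftrightarrow>
     (\<forall>i. A $ i $ i \<le> 0) \<and> (\<forall>i j. i \<noteq> j \<longrightarrow> 0 \<le> A $ i $ j) \<and> (\<forall>i. (\<Sum>j\<in>UNIV. A $ i $ j) \<le> 0)"

definition exit_rates :: "real ^ 'n ^ 'n \<Rightarrow> real ^ 'n" where
  "exit_rates A = - (A *v vec 1)"

text \<open>A process which lives on the states \<open>Inl i\<close> with rates \<open>A\<close>, jumps from them to the states
  \<open>Inr j\<close> with rates \<open>B\<close>, and is frozen from then on, has intensity matrix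
  \<open>exit_generator A B\<close>.\<close>

definition exit_generator :: "real ^ 'n ^ 'n \<Rightarrow> real ^ 'm ^ 'n \<Rightarrow> real ^ ('n + 'm) ^ ('n + 'm)" where
  "exit_generator A B = block_matrix A B 0 0"

text \<open>On the null event that the process never leaves the \<open>Inl\<close> states, \<open>exit_time\<close> is the
  constant \<open>Inf {}\<close> and \<open>exit_state\<close> is arbitrary but constant, so both stay measurable.\<close>

definition exit_time :: "(real \<Rightarrow> 'w \<Rightarrow> 'a + 'b) \<Rightarrow> 'w \<Rightarrow> real" where
  "exit_time X \<omega> = Inf {t. 0 \<le> t \<and> X t \<omega> \<in> range Inr}"

definition exit_state :: "(real \<Rightarrow> 'w \<Rightarrow> 'a + 'b) \<Rightarrow> 'w \<Rightarrow> 'b" where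
  "exit_state X \<omega> =
     (if \<exists>t\<ge>0. X t \<omega> \<in> range Inr then projr (X (exit_time X \<omega>) \<omega>) else undefined)"

definition path_events :: "'w measure \<Rightarrow> (real \<Rightarrow> 'w \<Rightarrow> 'x) \<Rightarrow> 'w set set" where
  "path_events M X = sigma_sets (space M) {X t -` A \<inter> space M | t A. 0 \<le> t}"


section \<open>The CSPH distribution\<close>

text \<open>The pre-shock states are the elements of \<open>'e\<close>, the post-shock states those of \<open>'s\<close>; their
  disjoint union is \<open>'e + 's\<close>.  Transience of all states for a subintensity matrix is expressed
  in its equivalent form, nonsingularity.\<close>

definition csph_parameters ::
  "real ^ 'e \<Rightarrow> real ^ 'e ^ 'e \<Rightarrow> real ^ 's ^ 'e \<Rightarrow> real ^ 's ^ 's \<Rightarrow> real ^ 's ^ 's \<Rightarrow>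
   real \<Rightarrow> real \<Rightarrow> bool"
where
  "csph_parameters \<alpha> T U Q1 Q2 a1 a2 \<longleftrightarrow>
     (\<forall>i. 0 \<le> \<alpha> $ i) \<and> (\<Sum>i\<in>UNIV. \<alpha> $ i) = 1 \<and>
     subintensity T \<and> invertible T \<and>
     (\<forall>i k. 0 \<le> U $ i $ k) \<and> T *v vec 1 + U *v vec 1 = 0 \<and>
     subintensity Q1 \<and> invertible Q1 \<and>
     subintensity Q2 \<and> invertible Q2 \<and>
     0 < a1 \<and> 0 < a2"

text \<open>\<open>Z\<close> is the pre-shock process, run until the common shock and frozen in the state then
  entered; \<open>J1\<close> and \<open>J2\<close> are the two post-shock processes, with time measured from the common
  shock and \<open>Inr 1\<close> as their absorbing state.  Their law, and their mutual independence from each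
  other and from the shock time, are prescribed conditionally on the shock state \<open>k\<close>, for each
  \<open>k\<close> of positive probability.\<close>

definition csph_processes ::
  "'w measure \<Rightarrow>
   real ^ 'e \<Rightarrow> real ^ 'e ^ 'e \<Rightarrow> real ^ 's ^ 'e \<Rightarrow> real ^ 's ^ 's \<Rightarrow> real ^ 's ^ 's \<Rightarrow>
   (real \<Rightarrow> 'w \<Rightarrow> 'e::finite + 's::finite) \<Rightarrow>
   (real \<Rightarrow> 'w \<Rightarrow> 's + 1) \<Rightarrow> (real \<Rightarrow> 'w \<Rightarrow> 's + 1) \<Rightarrow> bool"
where
  "csph_processes M \<alpha> T U Q1 Q2 Z J1 J2 \<longleftrightarrow>
     markov_jump_process M (exit_generator T U)
       (\<chi> x. case x of Inl i \<Rightarrow> \<alpha> $ i | Inr k \<Rightarrow> 0) Z \<and>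
     (\<forall>t\<ge>0. J1 t \<in> measurable M (count_space UNIV) \<and> J2 t \<in> measurable M (count_space UNIV)) \<and>
     (\<forall>k. measure M {\<omega>\<in>space M. exit_state Z \<omega> = k} > 0 \<longrightarrow>
        (let N = uniform_measure M {\<omega>\<in>space M. exit_state Z \<omega> = k} in
           markov_jump_process N (exit_generator Q1 (columnvector (exit_rates Q1)))
             (axis (Inl k) 1) J1 \<and>
           markov_jump_process N (exit_generator Q2 (columnvector (exit_rates Q2)))
             (axis (Inl k) 1) J2 \<and>
           prob_space.indep_sets N
             (\<lambda>i::nat. [sets (vimage_algebra (space M) (exit_time Z) borel),
                        path_events M J1, path_events M J2] ! i) {..<3}))"

definition shock_matrix :: "real ^ 's ^ 'e \<Rightarrow> real ^ ('s \<times> 's) ^ 'e" where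
  "shock_matrix U =
     (\<Sum>k\<in>UNIV. (columnvector (U *v axis k 1) :: real ^ 1 ^ 'e) **
               rowvector (kron_vec (axis k 1) (axis k 1)))"

text \<open>A real density is required to be nonnegative everywhere, since the conversion to \<open>ennreal\<close>
  would silently truncate negative values to 0.\<close>

definition has_density :: "'w measure \<Rightarrow> 'b measure \<Rightarrow> ('w \<Rightarrow> 'b) \<Rightarrow> ('b \<Rightarrow> real) \<Rightarrow> bool" where
  "has_density M N X f \<longleftrightarrow> (\<forall>x. 0 \<le> f x) \<and> distributed M N X (\<lambda>x. ennreal (f x))"

end

theory Submission
  imports Defs
begin

text \<open>Everything reduces to the law of a single absorbed process. Let \<open>X\<close> live on the states \<open>Inl i\<close> with
  rates \<open>A\<close> and jump with rates \<open>B\<close> to frozen states \<open>Inr k\<close>. Its transition function solves the forward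
  equation \<open>P' = P ** G\<close> with \<open>G = exit_generator A B\<close>, so \<open>P t\<close> is the matrix exponential of \<open>t *\<^sub>R G\<close>
  (\<open>transition_function_eq_matrix_exp\<close>). Since the states \<open>Inr k\<close> are frozen, having left by time \<open>a\<close>
  through \<open>k\<close> is almost surely the same as being in \<open>Inr k\<close> at time \<open>a\<close> (\<open>prob_exit\<close>). The probability of
  the latter is a block of the exponential, and differentiating that block in \<open>a\<close> gives the density
  \<open>\<alpha> exp(A t) B\<close> of the exit time on the event that the exit state is \<open>k\<close> (\<open>emeasure_exit\<close>). That the
  process does leave almost surely is where nonsingularity of \<open>A\<close> enters (\<open>survival_bound\<close>).

  This applies to the pre-shock process and, conditionally on the shock state \<open>k\<close>, to both post-shock
  processes. Conditional independence turns the three densities into a product, and summing over \<open>k\<close>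
  yields the density of the triple (\<open>triple_distributed\<close>); \<open>shock_matrix U\<close> is the bookkeeping
  device for this sum over a common \<open>k\<close> (\<open>shock_matrix_mult_kron_vec\<close>).

  For the pair \<open>(X1, X2)\<close>, translating the two residual times by \<open>a1 t\<close> and \<open>a2 t\<close> and integrating
  out the shock time \<open>t\<close> by Tonelli shows that its density at \<open>(z1, z2)\<close> is the integral of
  \<open>g (t, z1 - a1 t, z2 - a2 t)\<close>, in which only \<open>0 \<le> t \<le> m = min (z1 / a1) (z2 / a2)\<close> contributes. Because
  the Kronecker product of two exponentials is the exponential of the Kronecker sum, the integrand is
  \<open>\<alpha> exp(T t) S exp(C (m - t)) w\<close> with \<open>S\<close> the shock matrix, \<open>C\<close> the Kronecker sum of \<open>a1 Q1\<close> and \<open>a2 Q2\<close>, and \<open>w\<close> not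
  depending on \<open>t\<close>. Its antiderivative in \<open>t\<close> is \<open>\<alpha> V[T, S, C, t] exp(C (m - t)) w\<close>, by Duhamel's
  formula (\<open>V_block_duhamel_has_vector_derivative\<close>), whose value at \<open>t = m\<close> is the asserted density.\<close>

section \<open>The matrix exponential\<close>

lemma bounded_bilinear_matrix_matrix_mult:
  "bounded_bilinear ((**) :: real ^ 'n ^ 'm \<Rightarrow> real ^ 'p ^ 'n \<Rightarrow> real ^ 'p ^ 'm)"
proof -
  have "bilinear ((**) :: real ^ 'n ^ 'm \<Rightarrow> real ^ 'p ^ 'n \<Rightarrow> real ^ 'p ^ 'm)"
    unfolding bilinear_def linear_iff
    by (auto simp: vec_eq_iff matrix_matrix_mult_def sum.distrib algebra_simps sum_distrib_left)
  then show ?thesis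
    by (simp add: bilinear_conv_bounded_bilinear)
qed

lemma bounded_bilinear_matrix_vector_mult:
  "bounded_bilinear ((*v) :: real ^ 'n ^ 'm \<Rightarrow> real ^ 'n \<Rightarrow> real ^ 'm)"
proof -
  have "bilinear ((*v) :: real ^ 'n ^ 'm \<Rightarrow> real ^ 'n \<Rightarrow> real ^ 'm)"
    unfolding bilinear_def linear_iff
    by (auto simp: vec_eq_iff matrix_vector_mult_def sum.distrib algebra_simps sum_distrib_left)
  then show ?thesis
    by (simp add: bilinear_conv_bounded_bilinear)
qed

lemma bounded_bilinear_kron_vec:
  "bounded_bilinear (kron_vec :: real ^ 'm \<Rightarrow> real ^ 'p \<Rightarrow> real ^ ('m \<times> 'p))"
proof -
  have "bilinear (kron_vec :: real ^ 'm \<Rightarrow> real ^ 'p \<Rightarrow> real ^ ('m \<times> 'p))"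
    unfolding bilinear_def linear_iff
    by (auto simp: vec_eq_iff kron_vec_def algebra_simps)
  then show ?thesis
    by (simp add: bilinear_conv_bounded_bilinear)
qed

lemma has_vector_derivative_vecI:
  fixes f :: "real \<Rightarrow> 'a :: euclidean_space ^ 'n"
  assumes "\<And>i. ((\<lambda>t. f t $ i) has_vector_derivative D $ i) F"
  shows "(f has_vector_derivative D) F"
proof -
  have lin: "bounded_linear (\<lambda>x :: 'a. axis i x :: 'a ^ 'n)" for i
    by (auto simp: linear_conv_bounded_linear[symmetric] linear_iff vec_eq_iff axis_def)
  have "((\<lambda>t. \<Sum>i\<in>UNIV. axis i (f t $ i)) has_vector_derivative (\<Sum>i\<in>UNIV. axis i (D $ i))) F"
    by (intro has_vector_derivative_sum bounded_linear.has_vector_derivative[OF lin] assms)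
  moreover have "(\<Sum>i\<in>UNIV. axis i (x $ i)) = x" for x :: "'a ^ 'n"
    by (simp add: vec_eq_iff axis_def if_distrib cong: if_cong)
  ultimately show ?thesis by simp
qed

lemma has_vector_derivative_nth_nth:
  fixes f :: "real \<Rightarrow> real ^ 'n ^ 'm"
  assumes "(f has_vector_derivative D) F"
  shows "((\<lambda>t. f t $ i $ j) has_vector_derivative D $ i $ j) F"
  by (intro bounded_linear.has_vector_derivative[OF bounded_linear_vec_nth] assms)

lemma matrix_mult_nth: "(A ** B) $ i $ j = (\<Sum>k\<in>UNIV. A $ i $ k * B $ k $ j)"
  by (simp add: matrix_matrix_mult_def)

lemma matrix_vector_mult_nth: "(A *v x) $ i = (\<Sum>k\<in>UNIV. A $ i $ k * x $ k)"
  by (simp add: matrix_vector_mult_def)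

lemma matrix_power_scaleR:
  fixes A :: "real ^ 'n ^ 'n"
  shows "(((**) (t *\<^sub>R A)) ^^ n) (mat 1) = (t ^ n) *\<^sub>R (((**) A) ^^ n) (mat 1)"
proof (induction n)
  case (Suc n)
  have "(t *\<^sub>R A) ** (t ^ n *\<^sub>R X) = t ^ Suc n *\<^sub>R (A ** X)" for X :: "real ^ 'n ^ 'n"
    by (simp add: mult.commute bounded_bilinear.scaleR_left[OF bounded_bilinear_matrix_matrix_mult]
      bounded_bilinear.scaleR_right[OF bounded_bilinear_matrix_matrix_mult])
  with Suc show ?case
    by (simp only: funpow.simps o_apply)
qed simp

lemma matrix_power_Suc_right:
  "(((**) A) ^^ Suc n) (mat 1) = (((**) A) ^^ n) (mat 1) ** (A :: real ^ 'n ^ 'n)"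
proof (induction n)
  case (Suc n)
  have "(((**) A) ^^ Suc (Suc n)) (mat 1) = A ** (((**) A) ^^ Suc n) (mat 1)" by simp
  also have "\<dots> = (((**) A) ^^ Suc n) (mat 1) ** A"
    by (subst Suc) (simp add: matrix_mul_assoc)
  finally show ?case .
qed simp

text \<open>The sum of the absolute values of the entries is a submultiplicative norm that dominates every
  entry; this makes all entries of the exponential everywhere convergent power series.\<close>

lemma matrix_power_entry_bound:
  fixes A :: "real ^ 'n ^ 'n"
  shows "\<bar>(((**) A) ^^ n) (mat 1) $ i $ j\<bar> \<le> (\<Sum>i\<in>UNIV. \<Sum>j\<in>UNIV. \<bar>A $ i $ j\<bar>) ^ n"
    (is "_ \<le> ?c ^ n")
proof (induction n arbitrary: i)
  case 0
  then show ?case by (simp add: mat_def)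
next
  case (Suc n)
  have c: "0 \<le> ?c" by (intro sum_nonneg) simp
  have "\<bar>(((**) A) ^^ Suc n) (mat 1) $ i $ j\<bar> \<le> (\<Sum>k\<in>UNIV. \<bar>A $ i $ k\<bar> * ?c ^ n)"
    by (auto simp: matrix_matrix_mult_def abs_mult intro!: order_trans[OF sum_abs] sum_mono mult_left_mono Suc)
  also have "\<dots> = (\<Sum>k\<in>UNIV. \<bar>A $ i $ k\<bar>) * ?c ^ n" by (simp add: sum_distrib_right)
  also have "\<dots> \<le> ?c * ?c ^ n"
    by (intro mult_right_mono member_le_sum[where f = "\<lambda>i. \<Sum>k\<in>UNIV. \<bar>A $ i $ k\<bar>"]) (auto simp: c sum_nonneg)
  finally show ?case by simp
qed

lemma matrix_power_series_summable:
  fixes A :: "real ^ 'n ^ 'n"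
  shows "summable (\<lambda>n. ((((**) A) ^^ n) (mat 1) $ i $ j / fact n) * t ^ n)"
proof (rule summable_comparison_test')
  let ?c = "\<Sum>i\<in>UNIV. \<Sum>j\<in>UNIV. \<bar>A $ i $ j\<bar>"
  show "summable (\<lambda>n. (?c * \<bar>t\<bar>) ^ n / fact n)"
    using summable_exp[of "?c * \<bar>t\<bar>"] by (simp add: field_simps)
  show "norm (((((**) A) ^^ n) (mat 1) $ i $ j / fact n) * t ^ n) \<le> (?c * \<bar>t\<bar>) ^ n / fact n" for n
    using mult_right_mono[OF matrix_power_entry_bound[of n A i j], of "\<bar>t\<bar> ^ n / fact n"]
    by (simp add: abs_mult power_mult_distrib power_abs)
qed

lemma matrix_exp_nth_eq_power_series:
  fixes A :: "real ^ 'n ^ 'n"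
  shows "matrix_exp (t *\<^sub>R A) $ i $ j = (\<Sum>n. ((((**) A) ^^ n) (mat 1) $ i $ j / fact n) * t ^ n)"
proof -
  let ?S = "\<chi> i j. \<Sum>n. ((((**) A) ^^ n) (mat 1) $ i $ j / fact n) * t ^ n"
  have "(\<lambda>n. (1 / fact n) *\<^sub>R (((**) (t *\<^sub>R A)) ^^ n) (mat 1)) sums ?S"
    unfolding sums_def
  proof (intro vec_tendstoI)
    fix i j
    have "(\<lambda>n. \<Sum>m<n. ((((**) A) ^^ m) (mat 1) $ i $ j / fact m) * t ^ m) \<longlonglongrightarrow> ?S $ i $ j"
      using summable_LIMSEQ[OF matrix_power_series_summable[of A i j t]] by simp
    then show "(\<lambda>n. (\<Sum>m<n. (1 / fact m) *\<^sub>R (((**) (t *\<^sub>R A)) ^^ m) (mat 1)) $ i $ j) \<longlonglongrightarrow> ?S $ i $ j"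
      by (simp add: matrix_power_scaleR mult.commute)
  qed
  then show ?thesis
    by (simp add: matrix_exp_def sums_iff)
qed

text \<open>Termwise differentiation of the entries. Splitting off a factor \<open>A\<close> of \<open>A ^ (n + 1)\<close> on the right or
  on the left gives the two forms of the derivative; together they show that \<open>A\<close> commutes with its
  exponential.\<close>

lemma matrix_exp_has_vector_derivative:
  fixes A :: "real ^ 'n ^ 'n"
  shows "((\<lambda>t. matrix_exp (t *\<^sub>R A)) has_vector_derivative matrix_exp (t *\<^sub>R A) ** A) (at t)"
    and "((\<lambda>t. matrix_exp (t *\<^sub>R A)) has_vector_derivative A ** matrix_exp (t *\<^sub>R A)) (at t)"
proof -
  let ?c = "\<lambda>i j n. (((**) A) ^^ n) (mat 1) $ i $ j / fact n"
  have diffs: "diffs (?c i j) n = (((**) A) ^^ Suc n) (mat 1) $ i $ j / fact n" for i j n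
    by (simp add: diffs_def del: funpow.simps of_nat_Suc)
  have D: "((\<lambda>t. matrix_exp (t *\<^sub>R A) $ i $ j) has_vector_derivative (\<Sum>n. diffs (?c i j) n * t ^ n)) (at t)" for i j
    unfolding matrix_exp_nth_eq_power_series has_real_derivative_iff_has_vector_derivative[symmetric]
    by (intro termdiffs_strong_converges_everywhere matrix_power_series_summable)
  have S: "(\<lambda>n. ?c i j n * t ^ n) sums matrix_exp (t *\<^sub>R A) $ i $ j" for i j
    unfolding matrix_exp_nth_eq_power_series by (intro summable_sums matrix_power_series_summable)
  have "(\<lambda>n. \<Sum>k\<in>UNIV. (?c i k n * t ^ n) * A $ k $ j) sums (matrix_exp (t *\<^sub>R A) ** A) $ i $ j" for i j
    unfolding matrix_mult_nth by (intro sums_sum sums_mult2 S)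
  moreover have "diffs (?c i j) n * t ^ n = (\<Sum>k\<in>UNIV. (?c i k n * t ^ n) * A $ k $ j)" for i j n
    unfolding diffs matrix_power_Suc_right
    by (simp add: matrix_matrix_mult_def sum_divide_distrib sum_distrib_left sum_distrib_right ac_simps)
  ultimately have "(\<Sum>n. diffs (?c i j) n * t ^ n) = (matrix_exp (t *\<^sub>R A) ** A) $ i $ j" for i j
    by (simp add: sums_iff)
  then show "((\<lambda>t. matrix_exp (t *\<^sub>R A)) has_vector_derivative matrix_exp (t *\<^sub>R A) ** A) (at t)"
    using D by (intro has_vector_derivative_vecI) simp
  have "(\<lambda>n. \<Sum>k\<in>UNIV. A $ i $ k * (?c k j n * t ^ n)) sums (A ** matrix_exp (t *\<^sub>R A)) $ i $ j" for i j
    unfolding matrix_mult_nth by (intro sums_sum sums_mult S)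
  moreover have "diffs (?c i j) n * t ^ n = (\<Sum>k\<in>UNIV. A $ i $ k * (?c k j n * t ^ n))" for i j n
    unfolding diffs
    by (simp add: matrix_matrix_mult_def sum_divide_distrib sum_distrib_left sum_distrib_right ac_simps)
  ultimately have "(\<Sum>n. diffs (?c i j) n * t ^ n) = (A ** matrix_exp (t *\<^sub>R A)) $ i $ j" for i j
    by (simp add: sums_iff)
  then show "((\<lambda>t. matrix_exp (t *\<^sub>R A)) has_vector_derivative A ** matrix_exp (t *\<^sub>R A)) (at t)"
    using D by (intro has_vector_derivative_vecI) simp
qed

lemma matrix_exp_zero [simp]: "matrix_exp (0 :: real ^ 'n ^ 'n) = mat 1"
  using matrix_exp_nth_eq_power_series[of 0 "0 :: real ^ 'n ^ 'n"]
  by (subst vec_eq_iff, subst vec_eq_iff) (simp del: times_divide_eq_left)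

lemma matrix_exp_reverse_has_vector_derivative:
  fixes A :: "real ^ 'n ^ 'n"
  shows "((\<lambda>s. matrix_exp ((u - s) *\<^sub>R A)) has_vector_derivative - (A ** matrix_exp ((u - s) *\<^sub>R A))) (at s within S)"
proof -
  have "((\<lambda>s. u - s) has_vector_derivative (- 1)) (at s within S)"
    by (auto intro!: derivative_eq_intros)
  from vector_diff_chain_within[OF this has_vector_derivative_at_within[OF matrix_exp_has_vector_derivative(2)]]
  show ?thesis by (simp add: o_def)
qed

text \<open>Linear differential equations have unique solutions: differentiating
  \<open>Y s ** matrix_exp ((u - s) *\<^sub>R A)\<close> in \<open>s\<close> gives 0, and this expression is \<open>Y u\<close> at \<open>s = u\<close> and
  \<open>Y 0 ** matrix_exp (u *\<^sub>R A)\<close> at \<open>s = 0\<close>.\<close>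

lemma linear_ode_right_unique:
  fixes Y :: "real \<Rightarrow> real ^ 'n ^ 'm"
  assumes S: "convex S" "0 \<in> S" "u \<in> S"
    and Y: "\<And>t. t \<in> S \<Longrightarrow> (Y has_vector_derivative Y t ** A) (at t within S)"
  shows "Y u = Y 0 ** matrix_exp (u *\<^sub>R A)"
proof -
  let ?f = "\<lambda>s. Y s ** matrix_exp ((u - s) *\<^sub>R A)"
  have "(?f has_vector_derivative 0) (at s within S)" if "s \<in> S" for s
  proof -
    have "(?f has_vector_derivative Y s ** (- (A ** matrix_exp ((u - s) *\<^sub>R A)))
           + Y s ** A ** matrix_exp ((u - s) *\<^sub>R A)) (at s within S)"
      using that by (intro bounded_bilinear.has_vector_derivative[OF bounded_bilinear_matrix_matrix_mult]
          matrix_exp_reverse_has_vector_derivative Y)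
    then show ?thesis
      by (simp add: matrix_mul_assoc bounded_bilinear.minus_right[OF bounded_bilinear_matrix_matrix_mult])
  qed
  from has_vector_derivative_zero_constant[OF \<open>convex S\<close> this]
  obtain c where "\<And>s. s \<in> S \<Longrightarrow> ?f s = c" by auto
  from this[OF \<open>u \<in> S\<close>] this[OF \<open>0 \<in> S\<close>] show ?thesis by simp
qed

text \<open>The same argument for \<open>y' = A y\<close>, with the exponential on the other side; here \<open>A\<close> has to be moved past
  its exponential.\<close>

lemma linear_ode_left_unique:
  fixes y :: "real \<Rightarrow> real ^ 'n"
  assumes "\<And>t. (y has_vector_derivative A *v y t) (at t)"
  shows "y u = matrix_exp (u *\<^sub>R A) *v y 0"
proof -
  let ?f = "\<lambda>s. matrix_exp ((u - s) *\<^sub>R A) *v y s"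
  have "(?f has_vector_derivative 0) (at s within UNIV)" for s
  proof -
    have *: "matrix_exp (r *\<^sub>R A) ** A = A ** matrix_exp (r *\<^sub>R A)" for r
      using matrix_exp_has_vector_derivative[of A r] vector_derivative_unique_at by blast
    have "(?f has_vector_derivative matrix_exp ((u - s) *\<^sub>R A) *v (A *v y s)
           + (- (A ** matrix_exp ((u - s) *\<^sub>R A))) *v y s) (at s within UNIV)"
      by (intro bounded_bilinear.has_vector_derivative[OF bounded_bilinear_matrix_vector_mult]
          matrix_exp_reverse_has_vector_derivative assms)
    then show ?thesis
      by (simp add: matrix_vector_mul_assoc * bounded_bilinear.minus_left[OF bounded_bilinear_matrix_vector_mult])
  qed
  from has_vector_derivative_zero_constant[OF convex_UNIV this]
  obtain c where "?f s = c" for s by (meson UNIV_I)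
  from this[of u] this[of 0] show ?thesis by simp
qed

lemma matrix_exp_add_mult_vec:
  fixes A :: "real ^ 'n ^ 'n"
  shows "matrix_exp ((s + t) *\<^sub>R A) *v w = matrix_exp (s *\<^sub>R A) *v (matrix_exp (t *\<^sub>R A) *v w)"
proof -
  have "((\<lambda>s. matrix_exp ((s + t) *\<^sub>R A) *v w) has_vector_derivative
      A *v (matrix_exp ((s + t) *\<^sub>R A) *v w)) (at s)" for s
  proof -
    have "((\<lambda>s. s + t) has_vector_derivative 1) (at s)"
      by (auto intro!: derivative_eq_intros)
    from vector_diff_chain_at[OF this matrix_exp_has_vector_derivative(2)]
    have "((\<lambda>s. matrix_exp ((s + t) *\<^sub>R A)) has_vector_derivative A ** matrix_exp ((s + t) *\<^sub>R A)) (at s)"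
      by (simp add: o_def)
    from bounded_linear.has_vector_derivative[OF bounded_bilinear.bounded_linear_left[OF bounded_bilinear_matrix_vector_mult] this]
    show ?thesis by (simp add: matrix_vector_mul_assoc)
  qed
  from linear_ode_left_unique[OF this] show ?thesis by simp
qed

lemma sum_UNIV_prod: "(\<Sum>x\<in>UNIV. f x) = (\<Sum>i\<in>UNIV. \<Sum>j\<in>UNIV. f (i, j))"
  for f :: "'a::finite \<times> 'b::finite \<Rightarrow> 'c::comm_monoid_add"
  by (simp add: sum.cartesian_product flip: UNIV_Times_UNIV)

lemma sum_UNIV_sum: "(\<Sum>x\<in>UNIV. f x) = (\<Sum>i\<in>UNIV. f (Inl i)) + (\<Sum>j\<in>UNIV. f (Inr j))"
  for f :: "'a::finite + 'b::finite \<Rightarrow> 'c::comm_monoid_add"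
  by (simp add: sum.Plus flip: UNIV_Plus_UNIV)

lemma kron_sum_mult_kron_vec:
  "kron_sum A B *v kron_vec v w = kron_vec (A *v v) w + kron_vec v (B *v w)"
proof -
  have "(\<Sum>j\<in>UNIV. \<Sum>k\<in>UNIV. (A $ a $ j * mat 1 $ b $ k + mat 1 $ a $ j * B $ b $ k) * (v $ j * w $ k))
      = (A *v v) $ a * w $ b + v $ a * (B *v w) $ b" for a b
  proof -
    have "(\<Sum>j\<in>UNIV. \<Sum>k\<in>UNIV. (A $ a $ j * mat 1 $ b $ k + mat 1 $ a $ j * B $ b $ k) * (v $ j * w $ k))
      = (\<Sum>j\<in>UNIV. A $ a $ j * v $ j) * (\<Sum>k\<in>UNIV. mat 1 $ b $ k * w $ k)
      + (\<Sum>j\<in>UNIV. mat 1 $ a $ j * v $ j) * (\<Sum>k\<in>UNIV. B $ b $ k * w $ k)"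
      by (simp add: sum_product sum.distrib algebra_simps) (rule sum.swap)
    also have "\<dots> = (A *v v) $ a * (mat 1 *v w) $ b + (mat 1 *v v) $ a * (B *v w) $ b"
      by (simp add: matrix_vector_mult_def)
    finally show ?thesis by simp
  qed
  then have "(kron_sum A B *v kron_vec v w) $ (a, b) = (A *v v) $ a * w $ b + v $ a * (B *v w) $ b" for a b
    unfolding matrix_vector_mult_nth[of "kron_sum A B"]
    by (simp add: kron_sum_def kron_def kron_vec_def sum_UNIV_prod)
  then show ?thesis
    by (auto simp: vec_eq_iff kron_vec_def)
qed

text \<open>Both sides solve \<open>y' = kron_sum A B *v y\<close>, by the product rule for \<open>kron_vec\<close>.\<close>

lemma matrix_exp_kron_sum:
  "matrix_exp (t *\<^sub>R kron_sum A B) *v kron_vec v w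
     = kron_vec (matrix_exp (t *\<^sub>R A) *v v) (matrix_exp (t *\<^sub>R B) *v w)"
proof -
  let ?y = "\<lambda>t. kron_vec (matrix_exp (t *\<^sub>R A) *v v) (matrix_exp (t *\<^sub>R B) *v w)"
  have D: "((\<lambda>t. matrix_exp (t *\<^sub>R C) *v x) has_vector_derivative C *v (matrix_exp (t *\<^sub>R C) *v x)) (at t)"
    for C :: "real ^ 'k ^ 'k" and x t
    using bounded_linear.has_vector_derivative[OF bounded_bilinear.bounded_linear_left[OF bounded_bilinear_matrix_vector_mult]
        matrix_exp_has_vector_derivative(2)]
    by (simp add: matrix_vector_mul_assoc)
  have "(?y has_vector_derivative kron_sum A B *v ?y t) (at t)" for t
    using bounded_bilinear.has_vector_derivative[OF bounded_bilinear_kron_vec D D]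
    by (simp add: kron_sum_mult_kron_vec add.commute)
  from linear_ode_left_unique[OF this] show ?thesis by simp
qed

section \<open>Exponentials of block triangular matrices\<close>

definition left_block :: "real ^ ('n::finite + 'q::finite) ^ 'm \<Rightarrow> real ^ 'n ^ 'm" where
  "left_block E = (\<chi> x j. E $ x $ Inl j)"

lemma bounded_linear_left_block: "bounded_linear left_block"
  by (auto simp: linear_conv_bounded_linear[symmetric] linear_iff vec_eq_iff left_block_def)

lemma left_block_mult_block_matrix: "left_block (E ** block_matrix A B 0 C) = left_block E ** A"
  by (simp add: vec_eq_iff left_block_def matrix_matrix_mult_def sum_UNIV_sum block_matrix_def)

text \<open>The left block column of a solution of \<open>E' = E ** block_matrix A B 0 C\<close> solves the closed equation
  \<open>Y' = Y ** A\<close>, since the lower left block of the coefficient vanishes.\<close>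

lemma left_block_matrix_exp_block_matrix:
  "left_block (matrix_exp (u *\<^sub>R block_matrix A B 0 C)) = left_block (mat 1) ** matrix_exp (u *\<^sub>R A)"
  using linear_ode_right_unique[of UNIV u "\<lambda>u. left_block (matrix_exp (u *\<^sub>R block_matrix A B 0 C))" A]
  by (simp add: bounded_linear.has_vector_derivative[OF bounded_linear_left_block]
      matrix_exp_has_vector_derivative(1) flip: left_block_mult_block_matrix[of _ A B C])

lemma matrix_exp_block_matrix_nth:
  "matrix_exp (u *\<^sub>R block_matrix A B 0 C) $ Inl i $ Inl j = matrix_exp (u *\<^sub>R A) $ i $ j"
  "matrix_exp (u *\<^sub>R block_matrix A B 0 C) $ Inl i $ Inr k = V_block A B C u $ i $ k"
proof -
  have "matrix_exp (u *\<^sub>R block_matrix A B 0 C) $ Inl i $ Inl j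
      = left_block (matrix_exp (u *\<^sub>R block_matrix A B 0 C)) $ Inl i $ j"
    by (simp add: left_block_def)
  then show "matrix_exp (u *\<^sub>R block_matrix A B 0 C) $ Inl i $ Inl j = matrix_exp (u *\<^sub>R A) $ i $ j"
    unfolding left_block_matrix_exp_block_matrix
    by (simp add: matrix_mult_nth left_block_def mat_def if_distrib[of "\<lambda>x. x * _"] cong: if_cong)
  show "matrix_exp (u *\<^sub>R block_matrix A B 0 C) $ Inl i $ Inr k = V_block A B C u $ i $ k"
    by (simp add: V_block_def block_row_def block_col_def matrix_mult_nth sum_UNIV_sum mat_def
        if_distrib[of "\<lambda>x. x * _"] if_distrib[of "\<lambda>x. _ * x"] cong: if_cong)
qed

lemma V_block_zero [simp]: "V_block A B C 0 = 0"
  by (simp add: vec_eq_iff mat_def flip: matrix_exp_block_matrix_nth(2))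

lemma V_block_has_vector_derivative:
  "((\<lambda>u. V_block A B C u) has_vector_derivative
      matrix_exp (u *\<^sub>R A) ** B + V_block A B C u ** C) (at u within S)"
proof (intro has_vector_derivative_vecI)
  fix i k
  have "((\<lambda>u. matrix_exp (u *\<^sub>R block_matrix A B 0 C) $ Inl i $ Inr k) has_vector_derivative
      (matrix_exp (u *\<^sub>R block_matrix A B 0 C) ** block_matrix A B 0 C) $ Inl i $ Inr k) (at u within S)"
    by (rule has_vector_derivative_nth_nth[OF has_vector_derivative_at_within[OF matrix_exp_has_vector_derivative(1)]])
  then show "((\<lambda>u. V_block A B C u $ i $ k) has_vector_derivative
      (matrix_exp (u *\<^sub>R A) ** B + V_block A B C u ** C) $ i $ k) (at u within S)"
    by (simp add: matrix_mult_nth sum_UNIV_sum matrix_exp_block_matrix_nth)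
      (simp add: block_matrix_def)
qed

text \<open>States of type \<open>Inr\<close> have zero rows in the generator, so their rows of the exponential never change:
  these states are absorbing.\<close>

lemma matrix_exp_exit_generator_Inr:
  "matrix_exp (u *\<^sub>R exit_generator A B) $ Inr k = mat 1 $ Inr k"
proof -
  let ?E = "\<lambda>u. matrix_exp (u *\<^sub>R exit_generator A B)"
  have "((\<lambda>u. ?E u $ Inr k) has_vector_derivative 0) (at u within UNIV)" for u
  proof -
    have "((\<lambda>u. ?E u $ Inr k) has_vector_derivative (exit_generator A B ** ?E u) $ Inr k) (at u)"
      by (intro bounded_linear.has_vector_derivative[OF bounded_linear_vec_nth] matrix_exp_has_vector_derivative(2))
    moreover have "(exit_generator A B ** ?E u) $ Inr k = 0"
      by (simp add: vec_eq_iff matrix_mult_nth sum_UNIV_sum exit_generator_def)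
        (simp add: block_matrix_def)
    ultimately show ?thesis by simp
  qed
  from has_vector_derivative_zero_constant[OF convex_UNIV this]
  obtain c where "?E u $ Inr k = c" for u by (meson UNIV_I)
  from this[of u] this[of 0] show ?thesis by simp
qed

text \<open>Duhamel's formula in differential form: as \<open>V' = exp(A s) B + V C\<close>, the term \<open>V C exp(C (u - s))\<close>
  cancels against the derivative of the second factor. Integrating over \<open>s\<close> from \<open>0\<close> to \<open>u\<close> exhibits
  \<open>V_block A B C u\<close> as a convolution of two exponentials.\<close>

lemma V_block_duhamel_has_vector_derivative:
  "((\<lambda>s. V_block A B C s ** matrix_exp ((u - s) *\<^sub>R C)) has_vector_derivative
      matrix_exp (s *\<^sub>R A) ** B ** matrix_exp ((u - s) *\<^sub>R C)) (at s within S)"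
proof -
  have "((\<lambda>s. V_block A B C s ** matrix_exp ((u - s) *\<^sub>R C)) has_vector_derivative
      V_block A B C s ** (- (C ** matrix_exp ((u - s) *\<^sub>R C)))
      + (matrix_exp (s *\<^sub>R A) ** B + V_block A B C s ** C) ** matrix_exp ((u - s) *\<^sub>R C)) (at s within S)"
    by (intro bounded_bilinear.has_vector_derivative[OF bounded_bilinear_matrix_matrix_mult]
        V_block_has_vector_derivative matrix_exp_reverse_has_vector_derivative)
  then show ?thesis
    by (simp add: bounded_bilinear.minus_right[OF bounded_bilinear_matrix_matrix_mult]
        bounded_bilinear.add_left[OF bounded_bilinear_matrix_matrix_mult] matrix_mul_assoc)
qed

text \<open>The row sums \<open>v t\<close> of \<open>exp(A t)\<close> are the survival probabilities. They are nonincreasing, and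
  \<open>A\<^sup>-\<^sup>1 *v v t\<close> is a bounded antiderivative of \<open>v t\<close>. Hence \<open>t\<close> times the value of \<open>v\<close> at \<open>t\<close> is at most
  the integral of \<open>v\<close> over \<open>[0, t]\<close>, which stays bounded.\<close>

lemma survival_bound:
  fixes A :: "real ^ 'n ^ 'n"
  assumes nonneg: "\<And>t i j. 0 \<le> t \<Longrightarrow> 0 \<le> matrix_exp (t *\<^sub>R A) $ i $ j"
    and le_1: "\<And>t i. 0 \<le> t \<Longrightarrow> (\<Sum>j\<in>UNIV. matrix_exp (t *\<^sub>R A) $ i $ j) \<le> 1"
    and "invertible A"
  shows "\<exists>C. \<forall>t>0. (\<Sum>j\<in>UNIV. matrix_exp (t *\<^sub>R A) $ i $ j) \<le> C / t"
proof -
  define v where "v t = matrix_exp (t *\<^sub>R A) *v vec 1" for t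
  have v_nth: "v t $ i = (\<Sum>j\<in>UNIV. matrix_exp (t *\<^sub>R A) $ i $ j)" for t i
    by (simp add: v_def matrix_vector_mult_def)
  have v01: "0 \<le> v t $ i" "v t $ i \<le> 1" if "0 \<le> t" for t i
    unfolding v_nth using that by (intro sum_nonneg nonneg le_1; assumption)+
  have antimono: "v t $ i \<le> v s $ i" if "0 \<le> s" "s \<le> t" for s t i
  proof -
    have "v t = matrix_exp (s *\<^sub>R A) *v v (t - s)"
      using matrix_exp_add_mult_vec[of s "t - s" A "vec 1"] by (simp add: v_def)
    then have "v t $ i = (\<Sum>j\<in>UNIV. matrix_exp (s *\<^sub>R A) $ i $ j * v (t - s) $ j)"
      by (simp add: matrix_vector_mult_def)
    also have "\<dots> \<le> (\<Sum>j\<in>UNIV. matrix_exp (s *\<^sub>R A) $ i $ j * 1)"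
      using that by (intro sum_mono mult_left_mono v01 nonneg) auto
    finally show ?thesis by (simp add: v_nth)
  qed
  obtain A' where A': "A' ** A = mat 1"
    using \<open>invertible A\<close> by (auto simp: invertible_def)
  have D: "((\<lambda>t. (A' *v v t) $ i) has_vector_derivative v t $ i) (at t)" for t
  proof -
    have "((\<lambda>t. A' *v v t) has_vector_derivative A' *v ((A ** matrix_exp (t *\<^sub>R A)) *v vec 1)) (at t)"
      unfolding v_def
      by (intro bounded_linear.has_vector_derivative[OF bounded_bilinear.bounded_linear_right[OF bounded_bilinear_matrix_vector_mult]]
        bounded_linear.has_vector_derivative[OF bounded_bilinear.bounded_linear_left[OF bounded_bilinear_matrix_vector_mult]]
        matrix_exp_has_vector_derivative(2))
    also have "A' *v ((A ** matrix_exp (t *\<^sub>R A)) *v vec 1) = v t"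
      by (simp add: v_def matrix_vector_mul_assoc matrix_mul_assoc A')
    finally show ?thesis
      by (rule bounded_linear.has_vector_derivative[OF bounded_linear_vec_nth])
  qed
  have bound: "\<bar>(A' *v v t) $ i\<bar> \<le> (\<Sum>j\<in>UNIV. \<bar>A' $ i $ j\<bar>)" if "0 \<le> t" for t
  proof -
    have "\<bar>(A' *v v t) $ i\<bar> \<le> (\<Sum>j\<in>UNIV. \<bar>A' $ i $ j\<bar> * \<bar>v t $ j\<bar>)"
      unfolding matrix_vector_mult_nth abs_mult[symmetric] by (rule sum_abs)
    also have "\<dots> \<le> (\<Sum>j\<in>UNIV. \<bar>A' $ i $ j\<bar> * 1)"
      using v01[OF that] by (intro sum_mono mult_left_mono) auto
    finally show ?thesis by simp
  qed
  have "v t $ i \<le> 2 * (\<Sum>j\<in>UNIV. \<bar>A' $ i $ j\<bar>) / t" if "0 < t" for t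
  proof -
    obtain z where z: "0 < z" "z < t" "(A' *v v t) $ i - (A' *v v 0) $ i = (t - 0) * v z $ i"
      using MVT2[OF \<open>0 < t\<close>, of "\<lambda>t. (A' *v v t) $ i" "\<lambda>t. v t $ i"] D
      by (auto simp: has_real_derivative_iff_has_vector_derivative)
    have "v t $ i * t \<le> v z $ i * t"
      using z that by (intro mult_right_mono antimono) auto
    also have "\<dots> \<le> 2 * (\<Sum>j\<in>UNIV. \<bar>A' $ i $ j\<bar>)"
      using z bound[of t] bound[of 0] that by (simp add: mult.commute)
    finally show ?thesis using that by (simp add: field_simps)
  qed
  then show ?thesis by (auto simp: v_nth)
qed

section \<open>Transition functions are matrix exponentials\<close>

text \<open>Writing both one-sided increments through the smaller of the two times avoids the inverse of \<open>P\<close>, and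
  lets continuity and differentiability at \<open>t\<close> from both sides follow from the behaviour at 0.\<close>

lemma transition_function_increment:
  assumes "transition_function P" "0 \<le> s" "0 \<le> t"
  shows "P s $ i $ j - P t $ i $ j = sgn (s - t) * (\<Sum>k\<in>UNIV. P (min s t) $ i $ k * (P \<bar>s - t\<bar> $ k $ j - mat 1 $ k $ j))"
proof -
  have *: "P (u + h) $ i $ j - P u $ i $ j = (\<Sum>k\<in>UNIV. P u $ i $ k * (P h $ k $ j - mat 1 $ k $ j))"
    if "0 \<le> u" "0 \<le> h" for u h
  proof -
    have "P (u + h) $ i $ j = (P u ** P h) $ i $ j" and "P u $ i $ j = (P u ** mat 1) $ i $ j"
      using assms that by (auto simp: transition_function_def)
    then show ?thesis
      by (simp only: matrix_mult_nth right_diff_distrib sum_subtractf)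
  qed
  show ?thesis
    using *[of s "t - s"] *[of t "s - t"] assms by (cases s t rule: linorder_cases) auto
qed

lemma transition_function_le_1:
  assumes "transition_function P" "0 \<le> t"
  shows "P t $ i $ j \<le> 1"
  using assms member_le_sum[of j UNIV "\<lambda>j. P t $ i $ j"] by (auto simp: transition_function_def)

lemma filterlim_abs_diff_at_0_within:
  assumes "0 \<le> (t :: real)"
  shows "filterlim (\<lambda>s. \<bar>s - t\<bar>) (at 0 within {0..}) (at t within {0..})"
proof -
  have "((\<lambda>s. \<bar>s - t\<bar>) \<longlongrightarrow> \<bar>t - t\<bar>) (at t within {0..})"
    by (intro tendsto_intros)
  then show ?thesis
    by (auto simp: filterlim_at eventually_at_filter)
qed

lemma transition_function_continuous:
  assumes P: "transition_function P" and G: "(P has_vector_derivative G) (at 0 within {0..})" and "0 \<le> t"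
  shows "((\<lambda>s. P s $ i $ j) \<longlongrightarrow> P t $ i $ j) (at t within {0..})"
proof -
  have "((\<lambda>h. P h $ k $ j) \<longlongrightarrow> P 0 $ k $ j) (at 0 within {0..})" for k
    using has_vector_derivative_continuous[OF G]
    by (intro tendsto_vec_nth) (simp add: continuous_within)
  then have "((\<lambda>h. P h $ k $ j - mat 1 $ k $ j) \<longlongrightarrow> 0) (at 0 within {0..})" for k
    using P by (auto simp: transition_function_def intro: LIM_zero)
  then have lim: "((\<lambda>s. \<Sum>k\<in>UNIV. \<bar>P \<bar>s - t\<bar> $ k $ j - mat 1 $ k $ j\<bar>) \<longlongrightarrow> 0) (at t within {0..})"
    by (intro tendsto_null_sum tendsto_rabs_zero filterlim_compose[OF _ filterlim_abs_diff_at_0_within[OF \<open>0 \<le> t\<close>]])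
  have "norm (P s $ i $ j - P t $ i $ j) \<le> (\<Sum>k\<in>UNIV. \<bar>P \<bar>s - t\<bar> $ k $ j - mat 1 $ k $ j\<bar>)" if "0 \<le> s" for s
  proof -
    have "norm (P s $ i $ j - P t $ i $ j) \<le> \<bar>\<Sum>k\<in>UNIV. P (min s t) $ i $ k * (P \<bar>s - t\<bar> $ k $ j - mat 1 $ k $ j)\<bar>"
      unfolding transition_function_increment[OF P that \<open>0 \<le> t\<close>] by (simp add: abs_mult abs_sgn_eq)
    also have "\<dots> \<le> (\<Sum>k\<in>UNIV. \<bar>P \<bar>s - t\<bar> $ k $ j - mat 1 $ k $ j\<bar>)"
    proof (intro order_trans[OF sum_abs] sum_mono)
      fix k
      have "\<bar>P (min s t) $ i $ k\<bar> \<le> 1"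
        using P that \<open>0 \<le> t\<close> transition_function_le_1[OF P, of "min s t" i k]
        by (auto simp: transition_function_def)
      from mult_right_mono[OF this abs_ge_zero]
      show "\<bar>P (min s t) $ i $ k * (P \<bar>s - t\<bar> $ k $ j - mat 1 $ k $ j)\<bar> \<le> \<bar>P \<bar>s - t\<bar> $ k $ j - mat 1 $ k $ j\<bar>"
        by (simp add: abs_mult)
    qed
    finally show ?thesis .
  qed
  then have "((\<lambda>s. P s $ i $ j - P t $ i $ j) \<longlongrightarrow> 0) (at t within {0..})"
    by (intro Lim_null_comparison[OF _ lim]) (auto simp: eventually_at_filter)
  then show ?thesis by (rule LIM_zero_cancel)
qed

lemma transition_function_has_vector_derivative:
  assumes P: "transition_function P" and G: "(P has_vector_derivative G) (at 0 within {0..})" and "0 \<le> t"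
  shows "(P has_vector_derivative P t ** G) (at t within {0..})"
proof (intro has_vector_derivative_vecI)
  fix i j
  have "((\<lambda>h. P h $ k $ j) has_real_derivative G $ k $ j) (at 0 within {0..})" for k
    unfolding has_real_derivative_iff_has_vector_derivative by (rule has_vector_derivative_nth_nth[OF G])
  then have "((\<lambda>h. (P h $ k $ j - mat 1 $ k $ j) / h) \<longlongrightarrow> G $ k $ j) (at 0 within {0..})" for k
    using P by (auto simp: has_field_derivative_iff transition_function_def)
  then have D: "((\<lambda>s. (P \<bar>s - t\<bar> $ k $ j - mat 1 $ k $ j) / \<bar>s - t\<bar>) \<longlongrightarrow> G $ k $ j) (at t within {0..})" for k
    by (rule filterlim_compose[OF _ filterlim_abs_diff_at_0_within[OF \<open>0 \<le> t\<close>]])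
  have C: "((\<lambda>s. P (min s t) $ i $ k) \<longlongrightarrow> P t $ i $ k) (at t within {0..})" for k
  proof (rule Lim_transform_bound[OF _ LIM_zero[OF transition_function_continuous[OF P G \<open>0 \<le> t\<close>]], THEN LIM_zero_cancel])
    show "\<forall>\<^sub>F s in at t within {0..}. norm (P (min s t) $ i $ k - P t $ i $ k) \<le> norm (P s $ i $ k - P t $ i $ k)"
      by (auto simp: min_def)
  qed
  have "((\<lambda>s. \<Sum>k\<in>UNIV. P (min s t) $ i $ k * ((P \<bar>s - t\<bar> $ k $ j - mat 1 $ k $ j) / \<bar>s - t\<bar>)) \<longlongrightarrow>
      (\<Sum>k\<in>UNIV. P t $ i $ k * G $ k $ j)) (at t within {0..})"
    by (intro tendsto_sum tendsto_mult C D)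
  moreover have "\<forall>\<^sub>F s in at t within {0..}.
      (\<Sum>k\<in>UNIV. P (min s t) $ i $ k * ((P \<bar>s - t\<bar> $ k $ j - mat 1 $ k $ j) / \<bar>s - t\<bar>))
      = (P s $ i $ j - P t $ i $ j) / (s - t)"
  proof -
    have "(\<Sum>k\<in>UNIV. P (min s t) $ i $ k * ((P \<bar>s - t\<bar> $ k $ j - mat 1 $ k $ j) / \<bar>s - t\<bar>))
      = (P s $ i $ j - P t $ i $ j) / (s - t)" if "0 \<le> s" "s \<noteq> t" for s
    proof -
      have "sgn (s - t) * x / (s - t) = x / \<bar>s - t\<bar>" for x
        using \<open>s \<noteq> t\<close> by (auto simp: sgn_real_def field_simps)
      then show ?thesis
        unfolding transition_function_increment[OF P \<open>0 \<le> s\<close> \<open>0 \<le> t\<close>]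
        by (simp add: sum_divide_distrib)
    qed
    then show ?thesis by (auto simp: eventually_at_filter)
  qed
  ultimately have "((\<lambda>s. (P s $ i $ j - P t $ i $ j) / (s - t)) \<longlongrightarrow> (P t ** G) $ i $ j) (at t within {0..})"
    unfolding matrix_mult_nth by (rule Lim_transform_eventually)
  then show "((\<lambda>s. P s $ i $ j) has_vector_derivative (P t ** G) $ i $ j) (at t within {0..})"
    by (simp add: has_field_derivative_iff flip: has_real_derivative_iff_has_vector_derivative)
qed

lemma transition_function_eq_matrix_exp:
  assumes P: "transition_function P" and G: "(P has_vector_derivative G) (at 0 within {0..})" and "0 \<le> t"
  shows "P t = matrix_exp (t *\<^sub>R G)"
  using linear_ode_right_unique[of "{0..}" t P G] transition_function_has_vector_derivative[OF P G] assms
  by (auto simp: transition_function_def)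

section \<open>Exit times of right-constant paths\<close>

definition right_constant :: "(real \<Rightarrow> 'w \<Rightarrow> 'x) \<Rightarrow> 'w \<Rightarrow> bool" where
  "right_constant X \<omega> \<longleftrightarrow> (\<forall>t\<ge>0. \<exists>\<epsilon>>0. \<forall>s\<in>{t..<t + \<epsilon>}. X s \<omega> = X t \<omega>)"

lemma right_constant_rational:
  assumes "right_constant X \<omega>" "0 \<le> t" "t < b"
  obtains q where "q \<in> \<rat>" "t < q" "q < b" "X q \<omega> = X t \<omega>"
proof -
  obtain \<epsilon> where \<epsilon>: "\<epsilon> > 0" "\<forall>s\<in>{t..<t + \<epsilon>}. X s \<omega> = X t \<omega>"
    using assms by (auto simp: right_constant_def)
  obtain q where "q \<in> \<rat>" "t < q" "q < min b (t + \<epsilon>)"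
    using Rats_dense_in_real[of t "min b (t + \<epsilon>)"] \<epsilon> \<open>t < b\<close> by auto
  moreover from this have "X q \<omega> = X t \<omega>" by (intro \<epsilon>(2)[rule_format]) simp
  ultimately show ?thesis by (intro that[of q]) simp_all
qed

text \<open>The infimum is attained: just after the exit time the path is constant, and by definition of the
  infimum it takes a value in \<open>range Inr\<close> there.\<close>

lemma exit_time_attained:
  assumes "right_constant X \<omega>" and "0 \<le> t" "X t \<omega> \<in> range Inr"
  shows "0 \<le> exit_time X \<omega>" "exit_time X \<omega> \<le> t" "X (exit_time X \<omega>) \<omega> \<in> range Inr"
proof -
  let ?S = "{t. 0 \<le> t \<and> X t \<omega> \<in> range Inr}"
  have S: "?S \<noteq> {}" "bdd_below ?S" using assms by (auto intro!: bdd_belowI[of _ 0])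
  show 0: "0 \<le> exit_time X \<omega>" and "exit_time X \<omega> \<le> t"
    unfolding exit_time_def using S assms by (auto intro!: cInf_greatest cInf_lower)
  obtain \<epsilon> where \<epsilon>: "\<epsilon> > 0" "\<forall>s\<in>{exit_time X \<omega>..<exit_time X \<omega> + \<epsilon>}. X s \<omega> = X (exit_time X \<omega>) \<omega>"
    using assms(1) 0 by (auto simp: right_constant_def)
  from \<epsilon>(1) have "Inf ?S < exit_time X \<omega> + \<epsilon>" by (simp add: exit_time_def)
  from cInf_lessD[OF S(1) this] obtain s where s: "s \<in> ?S" "s < exit_time X \<omega> + \<epsilon>"
    by blast
  moreover have "exit_time X \<omega> \<le> s"
    unfolding exit_time_def using S s by (intro cInf_lower) auto
  ultimately have "X s \<omega> = X (exit_time X \<omega>) \<omega>" by (intro \<epsilon>(2)[rule_format]) simp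
  with s(1) show "X (exit_time X \<omega>) \<omega> \<in> range Inr" by simp
qed

lemma exits_iff_rational:
  assumes "right_constant X \<omega>"
  shows "(\<exists>t\<ge>0. X t \<omega> \<in> R) \<longleftrightarrow> (\<exists>q\<in>\<rat> \<inter> {0..}. X q \<omega> \<in> R)"
proof
  assume "\<exists>t\<ge>0. X t \<omega> \<in> R"
  then obtain t where t: "0 \<le> t" "X t \<omega> \<in> R" by auto
  obtain q where "q \<in> \<rat>" "t < q" "X q \<omega> = X t \<omega>"
    using right_constant_rational[OF assms t(1), of "t + 1"] by auto
  with t show "\<exists>q\<in>\<rat> \<inter> {0..}. X q \<omega> \<in> R" by (intro bexI[of _ q]) auto
qed auto

text \<open>A path spends an interval in the state in which it exits, so rational times suffice to
  detect the exit. A path that never exits has exit time \<open>Inf {}\<close>, the last disjunct.\<close>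

lemma exit_time_less_iff:
  assumes "right_constant X \<omega>"
  shows "exit_time X \<omega> < a \<longleftrightarrow> (\<exists>q\<in>\<rat> \<inter> {0..<a}. X q \<omega> \<in> range Inr)
     \<or> (\<not> (\<exists>q\<in>\<rat> \<inter> {0..}. X q \<omega> \<in> range Inr) \<and> Inf ({} :: real set) < a)"
proof (cases "\<exists>t\<ge>0. X t \<omega> \<in> range Inr")
  case True
  then obtain t where t: "0 \<le> t" "X t \<omega> \<in> range Inr" by blast
  have "exit_time X \<omega> < a \<longleftrightarrow> (\<exists>q\<in>\<rat> \<inter> {0..<a}. X q \<omega> \<in> range Inr)"
  proof
    assume "exit_time X \<omega> < a"
    then obtain q where "q \<in> \<rat>" "exit_time X \<omega> < q" "q < a" "X q \<omega> = X (exit_time X \<omega>) \<omega>"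
      using right_constant_rational[OF assms exit_time_attained(1)[OF assms t]] by blast
    with exit_time_attained[OF assms t] show "\<exists>q\<in>\<rat> \<inter> {0..<a}. X q \<omega> \<in> range Inr"
      by (intro bexI[of _ q]) auto
  next
    assume "\<exists>q\<in>\<rat> \<inter> {0..<a}. X q \<omega> \<in> range Inr"
    then obtain q where "0 \<le> q" "q < a" "X q \<omega> \<in> range Inr"
      by (elim bexE, unfold Int_iff atLeastLessThan_iff) blast
    then show "exit_time X \<omega> < a"
      using exit_time_attained(2)[OF assms, of q] by linarith
  qed
  then show ?thesis using True exits_iff_rational[OF assms, of "range Inr"] by blast
next
  case False
  then have "{t. 0 \<le> t \<and> X t \<omega> \<in> range Inr} = {}" by blast
  then have "exit_time X \<omega> = Inf {}" unfolding exit_time_def by (rule arg_cong)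
  with False show ?thesis by (auto simp: image_iff)
qed

lemma exits_measurable:
  assumes X: "\<And>t. 0 \<le> t \<Longrightarrow> X t \<in> measurable N (count_space UNIV)" and "Q \<subseteq> {0..}" "countable Q"
  shows "{\<omega>\<in>space N. \<exists>q\<in>Q. X q \<omega> \<in> R} \<in> sets N"
proof -
  have "X q -` R \<inter> space N \<in> sets N" if "q \<in> Q" for q
    using measurable_sets[OF X, of q R] that assms(2) by auto
  then have "(\<Union>q\<in>Q. X q -` R \<inter> space N) \<in> sets N"
    using \<open>countable Q\<close> by (intro sets.countable_UN') auto
  also have "(\<Union>q\<in>Q. X q -` R \<inter> space N) = {\<omega>\<in>space N. \<exists>q\<in>Q. X q \<omega> \<in> R}" by auto
  finally show ?thesis .
qed

lemma exit_time_measurable: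
  assumes X: "\<And>t. 0 \<le> t \<Longrightarrow> X t \<in> measurable N (count_space UNIV)"
    and rc: "\<And>\<omega>. \<omega> \<in> space N \<Longrightarrow> right_constant X \<omega>"
  shows "exit_time X \<in> borel_measurable N"
  unfolding borel_measurable_iff_less
proof
  fix a :: real
  let ?H = "\<lambda>Q. {\<omega>\<in>space N. \<exists>q\<in>Q. X q \<omega> \<in> range Inr}"
  have "{\<omega>\<in>space N. exit_time X \<omega> < a}
      = ?H (\<rat> \<inter> {0..<a}) \<union> (if Inf ({} :: real set) < a then space N - ?H (\<rat> \<inter> {0..}) else {})"
    using exit_time_less_iff[OF rc, of _ a] by auto
  moreover have "?H (\<rat> \<inter> {0..<a}) \<in> sets N" "?H (\<rat> \<inter> {0..}) \<in> sets N"
    by (intro exits_measurable X countable_Int1 countable_rat; auto)+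
  ultimately show "{\<omega>\<in>space N. exit_time X \<omega> < a} \<in> sets N" by auto
qed

text \<open>The exit state is the value of the path at a random time. Rounding the exit time up to a strictly
  later multiple of \<open>1 / (n + 1)\<close> leaves only countably many times, at which the value is measurable; by
  right-constancy the rounded values eventually agree with the value at the exit time itself.\<close>

lemma exit_state_measurable:
  fixes X :: "real \<Rightarrow> 'w \<Rightarrow> 'a + 'b :: countable"
  assumes X: "\<And>t. 0 \<le> t \<Longrightarrow> X t \<in> measurable N (count_space UNIV)"
    and rc: "\<And>\<omega>. \<omega> \<in> space N \<Longrightarrow> right_constant X \<omega>"
  shows "exit_state X \<in> measurable N (count_space UNIV)"
proof -
  let ?\<tau> = "exit_time X"
  let ?H = "{\<omega>\<in>space N. \<exists>q\<in>\<rat> \<inter> {0..}. X q \<omega> \<in> range Inr}"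
  let ?Y = "\<lambda>n \<omega>. X ((real (nat \<lfloor>real (Suc n) * ?\<tau> \<omega>\<rfloor>) + 1) / real (Suc n)) \<omega>"
  have [measurable]: "?\<tau> \<in> borel_measurable N" by (rule exit_time_measurable[OF X rc])
  have [measurable]: "?Y n \<in> measurable N (count_space UNIV)" for n
    by (rule measurable_compose_countable[where f = "\<lambda>i. X ((real i + 1) / real (Suc n))"
          and g = "\<lambda>\<omega>. nat \<lfloor>real (Suc n) * ?\<tau> \<omega>\<rfloor>"]) (measurable, auto intro!: X)
  have [measurable]: "?H \<in> sets N" by (intro exits_measurable X countable_Int1 countable_rat) auto
  have Y_lim: "(\<forall>\<^sub>F n in sequentially. ?Y n \<omega> = X (?\<tau> \<omega>) \<omega>)" if "\<omega> \<in> ?H" for \<omega>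
  proof -
    have \<omega>: "right_constant X \<omega>" using rc that by auto
    from that obtain q where "0 \<le> q" "X q \<omega> \<in> range Inr" by (elim CollectE conjE bexE IntE) auto
    then have \<tau>: "0 \<le> ?\<tau> \<omega>" using exit_time_attained(1)[OF \<omega>] by blast
    obtain \<epsilon> where \<epsilon>: "\<epsilon> > 0" "\<forall>s\<in>{?\<tau> \<omega>..<?\<tau> \<omega> + \<epsilon>}. X s \<omega> = X (?\<tau> \<omega>) \<omega>"
      using \<omega> \<tau> by (auto simp: right_constant_def)
    obtain n0 where n0: "inverse (real (Suc n0)) < \<epsilon>" using reals_Archimedean[OF \<open>\<epsilon> > 0\<close>] by auto
    have "?Y n \<omega> = X (?\<tau> \<omega>) \<omega>" if "n0 \<le> n" for n
    proof -
      let ?m = "real (nat \<lfloor>real (Suc n) * ?\<tau> \<omega>\<rfloor>)"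
      have "0 \<le> real (Suc n) * ?\<tau> \<omega>" using \<tau> by simp
      then have m: "?m \<le> real (Suc n) * ?\<tau> \<omega>" "real (Suc n) * ?\<tau> \<omega> < ?m + 1" by linarith+
      have "inverse (real (Suc n)) \<le> inverse (real (Suc n0))" using that by simp
      with n0 have "1 / real (Suc n) < \<epsilon>" by (simp add: inverse_eq_divide)
      with m have "?\<tau> \<omega> < (?m + 1) / real (Suc n)" "(?m + 1) / real (Suc n) < ?\<tau> \<omega> + \<epsilon>"
        by (auto simp: field_simps)
      then show ?thesis by (intro \<epsilon>(2)[rule_format]) simp
    qed
    then show ?thesis by (auto simp: eventually_sequentially)
  qed
  have "{\<omega>\<in>space N. exit_state X \<omega> = k} \<in> sets N" for k
  proof -
    have "exit_state X \<omega> = k \<longleftrightarrow> (\<omega> \<in> ?H \<and> (\<forall>\<^sub>F n in sequentially. ?Y n \<omega> = Inr k)) \<or> (\<omega> \<notin> ?H \<and> undefined = k)"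
      if "\<omega> \<in> space N" for \<omega>
    proof (cases "\<omega> \<in> ?H")
      case True
      have rc': "right_constant X \<omega>" by (rule rc[OF that])
      from True exits_iff_rational[OF rc', of "range Inr"] obtain t where t: "0 \<le> t" "X t \<omega> \<in> range Inr" by blast
      from exit_time_attained(3)[OF rc' t] obtain k' where k': "X (?\<tau> \<omega>) \<omega> = Inr k'" by auto
      from t k' have "exit_state X \<omega> = k'" unfolding exit_state_def by auto
      moreover have "(\<forall>\<^sub>F n in sequentially. ?Y n \<omega> = Inr k) \<longleftrightarrow> k = k'"
      proof
        assume "\<forall>\<^sub>F n in sequentially. ?Y n \<omega> = Inr k"
        with Y_lim[OF True] have "\<forall>\<^sub>F n in sequentially. k = k'"
          by eventually_elim (simp add: k')
        then show "k = k'" by simp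
      next
        assume "k = k'"
        with Y_lim[OF True] k' show "\<forall>\<^sub>F n in sequentially. ?Y n \<omega> = Inr k" by simp
      qed
      ultimately show ?thesis using True by blast
    next
      case False
      with that exits_iff_rational[OF rc[OF that], of "range Inr"] have "\<not> (\<exists>t\<ge>0. X t \<omega> \<in> range Inr)" by blast
      then have "exit_state X \<omega> = undefined" by (auto simp: exit_state_def)
      with False show ?thesis by auto
    qed
    then have "{\<omega>\<in>space N. exit_state X \<omega> = k}
      = {\<omega>\<in>space N. (\<omega> \<in> ?H \<and> (\<forall>\<^sub>F n in sequentially. ?Y n \<omega> = Inr k)) \<or> (\<omega> \<notin> ?H \<and> undefined = k)}"
      by blast
    also have "\<dots> \<in> sets N" unfolding eventually_sequentially by measurable
    finally show ?thesis .
  qed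
  then show ?thesis
    by (subst measurable_count_space_eq2_countable) (auto simp: vimage_def Int_def conj_commute)
qed

section \<open>The law of the exit time and the exit state\<close>

definition inl_vec :: "real ^ 'a::finite \<Rightarrow> real ^ ('a + 'b::finite)" where
  "inl_vec \<alpha> = (\<chi> x. case x of Inl i \<Rightarrow> \<alpha> $ i | Inr k \<Rightarrow> 0)"

lemma inl_vec_nth [simp]: "inl_vec \<alpha> $ Inl i = \<alpha> $ i" "inl_vec \<alpha> $ Inr k = 0"
  by (simp_all add: inl_vec_def)

lemma axis_Inl: "axis (Inl k) 1 = inl_vec (axis k 1)"
  by (auto simp: vec_eq_iff inl_vec_def axis_def split: sum.split)

text \<open>For an absorbed process started from \<open>\<alpha>\<close>, the density of the exit time restricted to the event that
  the exit state is \<open>k\<close>. It integrates to the probability of that event.\<close>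

definition exit_density :: "real ^ 'a \<Rightarrow> real ^ 'a ^ 'a \<Rightarrow> real ^ 'b ^ 'a \<Rightarrow> 'b \<Rightarrow> real \<Rightarrow> real" where
  "exit_density \<alpha> A B k t =
     (if 0 \<le> t then \<Sum>i\<in>UNIV. \<alpha> $ i * (matrix_exp (t *\<^sub>R A) ** B) $ i $ k else 0)"

lemma matrix_exp_nth_continuous: "continuous_on UNIV (\<lambda>t. matrix_exp (t *\<^sub>R A) $ i $ j)"
  by (intro continuous_at_imp_continuous_on ballI
      has_vector_derivative_continuous[OF has_vector_derivative_nth_nth[OF matrix_exp_has_vector_derivative(1)]])

lemma matrix_exp_nth_measurable [measurable]:
  assumes [measurable]: "f \<in> borel_measurable M"
  shows "(\<lambda>x. matrix_exp (f x *\<^sub>R A) $ i $ j) \<in> borel_measurable M"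
  by (rule measurable_compose[OF assms borel_measurable_continuous_onI[OF matrix_exp_nth_continuous]])

lemma exit_density_measurable [measurable]: "exit_density \<alpha> A B k \<in> borel_measurable borel"
  unfolding exit_density_def[abs_def] matrix_mult_nth by measurable

locale absorbing_jump_process =
  fixes M :: "'w measure" and \<alpha> :: "real ^ 'a" and A :: "real ^ 'a ^ 'a" and B :: "real ^ 'b ^ 'a"
    and X :: "real \<Rightarrow> 'w \<Rightarrow> 'a + 'b"
  assumes process: "markov_jump_process M (exit_generator A B) (inl_vec \<alpha>) X"
    and invertible: "invertible A"
    and start_nonneg: "0 \<le> \<alpha> $ i"
    and rates_nonneg: "0 \<le> B $ i $ k"
begin

sublocale prob_space M
  using process by (simp add: markov_jump_process_def)

lemma X_measurable: "0 \<le> t \<Longrightarrow> X t \<in> measurable M (count_space UNIV)"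
  using process by (simp add: markov_jump_process_def)

lemma right_constant: "\<omega> \<in> space M \<Longrightarrow> right_constant X \<omega>"
  using process by (simp add: markov_jump_process_def right_constant_def)

lemma exit_time_borel [measurable]: "exit_time X \<in> borel_measurable M"
  by (rule exit_time_measurable[OF X_measurable right_constant])

lemma exit_state_count_space [measurable]: "exit_state X \<in> measurable M (count_space UNIV)"
  by (rule exit_state_measurable[OF X_measurable right_constant])

lemma X_sets: "0 \<le> t \<Longrightarrow> {\<omega>\<in>space M. X t \<omega> \<in> R} \<in> sets M"
  using measurable_sets[OF X_measurable, of t R] by (simp add: vimage_def Int_def conj_commute)

lemma X_eq_sets: "0 \<le> t \<Longrightarrow> {\<omega>\<in>space M. X t \<omega> = x} \<in> sets M"
  using X_sets[of t "{x}"] by simp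

abbreviation transition_matrix :: "real \<Rightarrow> real ^ ('a + 'b) ^ ('a + 'b)" where
  "transition_matrix t \<equiv> matrix_exp (t *\<^sub>R exit_generator A B)"

lemma transition_function_exists:
  obtains P where "transition_function P" "\<forall>t\<ge>0. P t = transition_matrix t"
    "\<forall>(n::nat) (t :: nat \<Rightarrow> real) x. t 0 = 0 \<longrightarrow> (\<forall>k<n. t k \<le> t (Suc k)) \<longrightarrow>
       prob {\<omega>\<in>space M. \<forall>k\<le>n. X (t k) \<omega> = x k} =
         inl_vec \<alpha> $ x 0 * (\<Prod>k<n. P (t (Suc k) - t k) $ x k $ x (Suc k))"
proof -
  from process have "\<exists>P. transition_function P \<and>
      (P has_vector_derivative exit_generator A B) (at 0 within {0..}) \<and>
      (\<forall>(n::nat) (t :: nat \<Rightarrow> real) x. t 0 = 0 \<longrightarrow> (\<forall>k<n. t k \<le> t (Suc k)) \<longrightarrow>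
         prob {\<omega>\<in>space M. \<forall>k\<le>n. X (t k) \<omega> = x k} =
           inl_vec \<alpha> $ x 0 * (\<Prod>k<n. P (t (Suc k) - t k) $ x k $ x (Suc k)))"
    unfolding markov_jump_process_def by (elim conjE)
  then show ?thesis
    by (elim exE conjE) (rule that, assumption, simp add: transition_function_eq_matrix_exp, assumption)
qed

lemma transition_matrix_stochastic:
  assumes "0 \<le> t"
  shows "0 \<le> transition_matrix t $ x $ y" "(\<Sum>y\<in>UNIV. transition_matrix t $ x $ y) = 1"
proof -
  obtain P where "transition_function P" "\<forall>t\<ge>0. P t = transition_matrix t" by (rule transition_function_exists)
  then show "0 \<le> transition_matrix t $ x $ y" "(\<Sum>y\<in>UNIV. transition_matrix t $ x $ y) = 1"
    using assms unfolding transition_function_def by (metis (no_types, lifting))+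
qed

lemma finite_dimensional_distribution:
  assumes "t 0 = 0" and mono: "\<And>k. k < n \<Longrightarrow> t k \<le> t (Suc k)"
  shows "prob {\<omega>\<in>space M. \<forall>k\<le>n. X (t k) \<omega> = x k} =
    inl_vec \<alpha> $ x 0 * (\<Prod>k<n. transition_matrix (t (Suc k) - t k) $ x k $ x (Suc k))"
proof -
  obtain P where P: "\<forall>t\<ge>0. P t = transition_matrix t"
    and fdd: "\<forall>(n::nat) (t :: nat \<Rightarrow> real) x. t 0 = 0 \<longrightarrow> (\<forall>k<n. t k \<le> t (Suc k)) \<longrightarrow>
       prob {\<omega>\<in>space M. \<forall>k\<le>n. X (t k) \<omega> = x k} =
         inl_vec \<alpha> $ x 0 * (\<Prod>k<n. P (t (Suc k) - t k) $ x k $ x (Suc k))"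
    by (rule transition_function_exists)
  have "prob {\<omega>\<in>space M. \<forall>k\<le>n. X (t k) \<omega> = x k} =
    inl_vec \<alpha> $ x 0 * (\<Prod>k<n. P (t (Suc k) - t k) $ x k $ x (Suc k))"
    using fdd assms by blast
  then show ?thesis
    using P mono by simp
qed

lemma matrix_exp_nonneg: "0 \<le> t \<Longrightarrow> 0 \<le> matrix_exp (t *\<^sub>R A) $ i $ j"
  using transition_matrix_stochastic(1)[of t "Inl i" "Inl j"] by (simp add: exit_generator_def matrix_exp_block_matrix_nth)

lemma matrix_exp_row_sum_le_1:
  assumes "0 \<le> t"
  shows "(\<Sum>j\<in>UNIV. matrix_exp (t *\<^sub>R A) $ i $ j) \<le> 1"
proof -
  have "(\<Sum>j\<in>UNIV. transition_matrix t $ Inl i $ Inl j) + (\<Sum>k\<in>UNIV. transition_matrix t $ Inl i $ Inr k) = 1"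
    using transition_matrix_stochastic(2)[OF assms, of "Inl i"] by (simp add: sum_UNIV_sum)
  moreover have "0 \<le> (\<Sum>k\<in>UNIV. transition_matrix t $ Inl i $ Inr k)"
    by (intro sum_nonneg transition_matrix_stochastic assms)
  ultimately show ?thesis
    by (simp add: exit_generator_def matrix_exp_block_matrix_nth)
qed

lemma exit_density_nonneg: "0 \<le> exit_density \<alpha> A B k t"
  unfolding exit_density_def matrix_mult_nth
  by (auto intro!: sum_nonneg mult_nonneg_nonneg start_nonneg rates_nonneg matrix_exp_nonneg)

lemma prob_two_times:
  assumes "0 \<le> s" "s \<le> t"
  shows "prob {\<omega>\<in>space M. X 0 \<omega> = x \<and> X s \<omega> = y \<and> X t \<omega> = z} = inl_vec \<alpha> $ x * transition_matrix s $ x $ y * transition_matrix (t - s) $ y $ z"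
proof -
  let ?t = "\<lambda>n::nat. if n = 0 then 0 else if n = 1 then s else t"
  let ?x = "\<lambda>n::nat. if n = 0 then x else if n = 1 then y else z"
  have le2: "(\<forall>k\<le>2. Q k) \<longleftrightarrow> Q 0 \<and> Q 1 \<and> Q 2" for Q :: "nat \<Rightarrow> bool"
    by (auto simp: numeral_2_eq_2 le_Suc_eq)
  have "prob {\<omega>\<in>space M. \<forall>k\<le>2. X (?t k) \<omega> = ?x k}
      = inl_vec \<alpha> $ ?x 0 * (\<Prod>k<2. transition_matrix (?t (Suc k) - ?t k) $ ?x k $ ?x (Suc k))"
    using assms by (intro finite_dimensional_distribution) (auto simp: less_Suc_eq numeral_2_eq_2)
  then show ?thesis
    unfolding le2 using assms by (simp add: numeral_2_eq_2 lessThan_Suc mult.assoc mult.left_commute mult.commute)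
qed

lemma prob_one_time:
  assumes "0 \<le> t"
  shows "prob {\<omega>\<in>space M. X t \<omega> = y} = (\<Sum>i\<in>UNIV. \<alpha> $ i * transition_matrix t $ Inl i $ y)"
proof -
  have "prob {\<omega>\<in>space M. X t \<omega> = y} = prob (\<Union>x\<in>UNIV. {\<omega>\<in>space M. X 0 \<omega> = x \<and> X 0 \<omega> = x \<and> X t \<omega> = y})"
    by (intro arg_cong[where f = prob]) auto
  also have "\<dots> = (\<Sum>x\<in>UNIV. prob {\<omega>\<in>space M. X 0 \<omega> = x \<and> X 0 \<omega> = x \<and> X t \<omega> = y})"
  proof (rule finite_measure_finite_Union)
    have "{\<omega>\<in>space M. X 0 \<omega> = x \<and> X 0 \<omega> = x \<and> X t \<omega> = y}
        = {\<omega>\<in>space M. X 0 \<omega> = x} \<inter> {\<omega>\<in>space M. X t \<omega> = y}" for x by auto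
    then show "(\<lambda>x. {\<omega>\<in>space M. X 0 \<omega> = x \<and> X 0 \<omega> = x \<and> X t \<omega> = y}) ` UNIV \<subseteq> sets M"
      using X_eq_sets assms by auto
  qed (auto simp: disjoint_family_on_def)
  also have "\<dots> = (\<Sum>x\<in>UNIV. inl_vec \<alpha> $ x * mat 1 $ x $ x * transition_matrix t $ x $ y)"
    using assms by (subst prob_two_times) simp_all
  also have "\<dots> = (\<Sum>i\<in>UNIV. \<alpha> $ i * transition_matrix t $ Inl i $ y)"
    by (simp add: sum_UNIV_sum mat_def)
  finally show ?thesis .
qed

lemma AE_frozen:
  assumes "0 \<le> s" "s \<le> t"
  shows "AE \<omega> in M. X s \<omega> = Inr k \<longrightarrow> X t \<omega> = Inr k"
proof -
  have "AE \<omega> in M. \<not> (X 0 \<omega> = x \<and> X s \<omega> = Inr k \<and> X t \<omega> = z)" if "z \<noteq> Inr k" for x z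
  proof -
    let ?N = "{\<omega>\<in>space M. X 0 \<omega> = x \<and> X s \<omega> = Inr k \<and> X t \<omega> = z}"
    have "prob ?N = 0"
      using that unfolding prob_two_times[OF assms] matrix_exp_exit_generator_Inr by (simp add: mat_def)
    moreover have "?N = {\<omega>\<in>space M. X 0 \<omega> = x} \<inter> {\<omega>\<in>space M. X s \<omega> = Inr k} \<inter> {\<omega>\<in>space M. X t \<omega> = z}"
      by auto
    then have "?N \<in> sets M" using X_eq_sets assms by auto
    ultimately show ?thesis
      by (auto intro!: AE_I[of _ _ ?N] simp: emeasure_eq_measure)
  qed
  then have "AE \<omega> in M. z \<noteq> Inr k \<longrightarrow> \<not> (X 0 \<omega> = x \<and> X s \<omega> = Inr k \<and> X t \<omega> = z)" for x z
    by (cases "z = Inr k") auto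
  then have "AE \<omega> in M. \<forall>x z. z \<noteq> Inr k \<longrightarrow> \<not> (X 0 \<omega> = x \<and> X s \<omega> = Inr k \<and> X t \<omega> = z)"
    by (simp only: AE_all_countable) blast
  then show ?thesis by eventually_elim blast
qed

text \<open>Never exiting entails being in some state \<open>Inl j\<close> at every time \<open>n + 1\<close>, which by
  \<open>survival_bound\<close> has probability \<open>O(1 / n)\<close>.\<close>

lemma AE_exits: "AE \<omega> in M. \<exists>t\<ge>0. X t \<omega> \<in> range Inr"
proof -
  let ?N = "space M - {\<omega>\<in>space M. \<exists>q\<in>\<rat> \<inter> {0..}. X q \<omega> \<in> range Inr}"
  have N: "?N \<in> sets M"
    by (intro sets.compl_sets exits_measurable X_measurable countable_Int1 countable_rat) auto
  have "\<exists>C. \<forall>t>0. (\<Sum>j\<in>UNIV. matrix_exp (t *\<^sub>R A) $ i $ j) \<le> C / t" for i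
    by (rule survival_bound[OF matrix_exp_nonneg matrix_exp_row_sum_le_1 invertible])
  then obtain C where C: "\<And>i t. 0 < t \<Longrightarrow> (\<Sum>j\<in>UNIV. matrix_exp (t *\<^sub>R A) $ i $ j) \<le> C i / t"
    by metis
  have le: "prob ?N \<le> (\<Sum>i\<in>UNIV. \<alpha> $ i * C i) * inverse (real (Suc n))" for n
  proof -
    let ?t = "real (Suc n)"
    have t: "?t \<in> \<rat> \<inter> {0..}" by simp
    have "?N \<subseteq> (\<Union>j\<in>UNIV. {\<omega>\<in>space M. X ?t \<omega> = Inl j})"
    proof
      fix \<omega> assume \<omega>: "\<omega> \<in> ?N"
      with t have "X ?t \<omega> \<notin> range Inr" by blast
      with \<omega> show "\<omega> \<in> (\<Union>j\<in>UNIV. {\<omega>\<in>space M. X ?t \<omega> = Inl j})"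
        by (cases "X ?t \<omega>") (auto simp del: of_nat_Suc)
    qed
    moreover have S: "{\<omega>\<in>space M. X ?t \<omega> = Inl j} \<in> sets M" for j
      using X_sets[of ?t "{Inl j}"] by simp
    ultimately have "prob ?N \<le> prob (\<Union>j\<in>UNIV. {\<omega>\<in>space M. X ?t \<omega> = Inl j})"
      by (intro finite_measure_mono) auto
    also have "\<dots> \<le> (\<Sum>j\<in>UNIV. prob {\<omega>\<in>space M. X ?t \<omega> = Inl j})"
      using S by (intro finite_measure_subadditive_finite) auto
    also have "\<dots> = (\<Sum>j\<in>UNIV. \<Sum>i\<in>UNIV. \<alpha> $ i * matrix_exp (?t *\<^sub>R A) $ i $ j)"
      by (subst prob_one_time) (simp_all add: exit_generator_def matrix_exp_block_matrix_nth)
    also have "\<dots> = (\<Sum>i\<in>UNIV. \<alpha> $ i * (\<Sum>j\<in>UNIV. matrix_exp (?t *\<^sub>R A) $ i $ j))"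
      by (subst sum.swap) (simp add: sum_distrib_left)
    also have "\<dots> \<le> (\<Sum>i\<in>UNIV. \<alpha> $ i * (C i / ?t))"
      by (intro sum_mono mult_left_mono C start_nonneg) simp
    also have "\<dots> = (\<Sum>i\<in>UNIV. \<alpha> $ i * C i) * inverse ?t"
      by (simp add: sum_distrib_right divide_inverse mult.assoc)
    finally show ?thesis .
  qed
  have "(\<lambda>n. (\<Sum>i\<in>UNIV. \<alpha> $ i * C i) * inverse (real (Suc n))) \<longlonglongrightarrow> 0"
    by (intro tendsto_mult_right_zero LIMSEQ_inverse_real_of_nat)
  then have "prob ?N \<le> 0"
    by (rule LIMSEQ_le_const) (use le in auto)
  then have "emeasure M ?N = 0"
    by (simp add: emeasure_eq_measure measure_le_0_iff)
  moreover have "{\<omega>\<in>space M. \<not> (\<exists>t\<ge>0. X t \<omega> \<in> range Inr)} \<subseteq> ?N"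
    by auto
  ultimately show ?thesis
    using N by (intro AE_I[of _ _ ?N]) auto
qed

text \<open>If the exit time is less than \<open>a\<close>, the path takes the exit state at some rational time in between
  and is frozen there until \<open>a\<close>; this holds almost surely because it is a statement about countably many
  times.\<close>

lemma prob_exit:
  assumes "0 \<le> a"
  shows "prob {\<omega>\<in>space M. exit_time X \<omega> \<le> a \<and> exit_state X \<omega> = k} = prob {\<omega>\<in>space M. X a \<omega> = Inr k}"
proof (rule finite_measure_eq_AE)
  have "AE \<omega> in M. \<forall>q\<in>\<rat> \<inter> {0..a}. \<forall>k. X q \<omega> = Inr k \<longrightarrow> X a \<omega> = Inr k"
    by (subst AE_ball_countable) (auto intro!: countable_Int1 countable_rat AE_frozen simp: AE_all_countable)
  then show "AE \<omega> in M. \<omega> \<in> {\<omega>\<in>space M. exit_time X \<omega> \<le> a \<and> exit_state X \<omega> = k}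
      \<longleftrightarrow> \<omega> \<in> {\<omega>\<in>space M. X a \<omega> = Inr k}"
    using AE_exits AE_space
  proof eventually_elim
    case (elim \<omega>)
    then have rc: "right_constant X \<omega>" using right_constant by blast
    from elim(2) obtain t where t: "0 \<le> t" "X t \<omega> \<in> range Inr" by blast
    obtain l where l: "X (exit_time X \<omega>) \<omega> = Inr l"
      using exit_time_attained(3)[of X \<omega>, OF rc t] by auto
    have state: "exit_state X \<omega> = l"
      using elim(2) l by (simp add: exit_state_def)
    have stays: "X a \<omega> = Inr l" if "exit_time X \<omega> \<le> a"
    proof (cases "exit_time X \<omega> = a")
      case False
      with that have "exit_time X \<omega> < a" by simp
      then obtain q where "q \<in> \<rat>" "exit_time X \<omega> < q" "q < a" "X q \<omega> = X (exit_time X \<omega>) \<omega>"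
        using right_constant_rational[of X \<omega>, OF rc exit_time_attained(1)[of X \<omega>, OF rc t]] by blast
      with elim(1) l exit_time_attained(1)[of X \<omega>, OF rc t] show ?thesis by auto
    qed (use l in auto)
    have "exit_time X \<omega> \<le> a" if "X a \<omega> = Inr k"
      using exit_time_attained(2)[of X \<omega>, OF rc \<open>0 \<le> a\<close>] that by auto
    with stays state elim(3) show ?case by auto
  qed
  show "{\<omega>\<in>space M. X a \<omega> = Inr k} \<in> sets M"
    using X_sets[OF assms, of "{Inr k}"] by simp
qed measurable

text \<open>The derivative of \<open>V_block A B 0\<close> is \<open>exp(A x) B\<close>, as the absorbing states contribute no rates.\<close>

lemma exit_density_nn_integral:
  "(\<integral>\<^sup>+x. ennreal (exit_density \<alpha> A B k x) * indicator {..a} x \<partial>lborel)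
     = ennreal (if 0 \<le> a then \<Sum>i\<in>UNIV. \<alpha> $ i * V_block A B 0 a $ i $ k else 0)"
proof (cases "0 \<le> a")
  case True
  have "(\<integral>\<^sup>+x. ennreal (exit_density \<alpha> A B k x) * indicator {..a} x \<partial>lborel)
      = (\<integral>\<^sup>+x. ennreal (exit_density \<alpha> A B k x) * indicator {0..a} x \<partial>lborel)"
    by (intro nn_integral_cong) (auto simp: exit_density_def indicator_def)
  also have "\<dots> = (\<Sum>i\<in>UNIV. \<alpha> $ i * V_block A B 0 a $ i $ k) - (\<Sum>i\<in>UNIV. \<alpha> $ i * V_block A B 0 0 $ i $ k)"
  proof (rule nn_integral_FTC_Icc)
    fix x assume "x \<in> {0..a}"
    have "((\<lambda>a. \<Sum>i\<in>UNIV. \<alpha> $ i * V_block A B 0 a $ i $ k) has_vector_derivative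
        (\<Sum>i\<in>UNIV. \<alpha> $ i * (matrix_exp (x *\<^sub>R A) ** B + V_block A B 0 x ** 0) $ i $ k)) (at x)"
      by (intro has_vector_derivative_sum has_vector_derivative_mult_right has_vector_derivative_nth_nth
          V_block_has_vector_derivative)
    with \<open>x \<in> {0..a}\<close>
    show "((\<lambda>a. \<Sum>i\<in>UNIV. \<alpha> $ i * V_block A B 0 a $ i $ k) has_real_derivative exit_density \<alpha> A B k x) (at x)"
      by (simp add: has_real_derivative_iff_has_vector_derivative exit_density_def)
  qed (use True in \<open>auto intro: exit_density_nonneg\<close>)
  finally show ?thesis using True by simp
next
  case False
  have "(\<integral>\<^sup>+x. ennreal (exit_density \<alpha> A B k x) * indicator {..a} x \<partial>lborel) = (\<integral>\<^sup>+x. 0 \<partial>(lborel :: real measure))"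
    using False by (intro nn_integral_cong) (auto simp: exit_density_def indicator_def)
  with False show ?thesis by simp
qed

lemma exit_law:
  "prob {\<omega>\<in>space M. exit_time X \<omega> \<le> a \<and> exit_state X \<omega> = k}
     = (if 0 \<le> a then \<Sum>i\<in>UNIV. \<alpha> $ i * V_block A B 0 a $ i $ k else 0)"
proof (cases "0 \<le> a")
  case True
  then show ?thesis
    by (simp add: prob_exit prob_one_time exit_generator_def matrix_exp_block_matrix_nth)
next
  case False
  have "AE \<omega> in M. \<not> (exit_time X \<omega> \<le> a)"
    using AE_exits AE_space
  proof eventually_elim
    case (elim \<omega>)
    then obtain t where t: "0 \<le> t" "X t \<omega> \<in> range Inr" by blast
    from exit_time_attained(1)[of X \<omega>, OF right_constant[OF elim(2)] t] False show ?case by simp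
  qed
  then have "prob {\<omega>\<in>space M. exit_time X \<omega> \<le> a \<and> exit_state X \<omega> = k} = prob {}"
    by (intro finite_measure_eq_AE) auto
  with False show ?thesis by simp
qed

lemma emeasure_exit:
  "emeasure M {\<omega>\<in>space M. exit_time X \<omega> \<le> a \<and> exit_state X \<omega> = k}
     = (\<integral>\<^sup>+x. ennreal (exit_density \<alpha> A B k x) * indicator {..a} x \<partial>lborel)"
  by (simp add: emeasure_eq_measure exit_law exit_density_nn_integral)

lemma exit_state_sets: "{\<omega>\<in>space M. exit_state X \<omega> = k} \<in> sets M"
  by measurable

lemma exit_time_distributed_conditionally:
  assumes p: "0 < prob {\<omega>\<in>space M. exit_state X \<omega> = k}"
  shows "distributed (uniform_measure M {\<omega>\<in>space M. exit_state X \<omega> = k}) lborel (exit_time X)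
    (\<lambda>x. ennreal (exit_density \<alpha> A B k x / prob {\<omega>\<in>space M. exit_state X \<omega> = k}))"
    (is "distributed ?N _ _ (\<lambda>x. ennreal (_ / ?p))")
proof (rule distributedI_borel_atMost[where
      g = "\<lambda>a. (if 0 \<le> a then \<Sum>i\<in>UNIV. \<alpha> $ i * V_block A B 0 a $ i $ k else 0) / ?p"])
  fix a :: real
  let ?c = "if 0 \<le> a then \<Sum>i\<in>UNIV. \<alpha> $ i * V_block A B 0 a $ i $ k else 0"
  have "(\<integral>\<^sup>+x. ennreal (exit_density \<alpha> A B k x / ?p * indicat_real {..a} x) \<partial>lborel)
      = (\<integral>\<^sup>+x. ennreal (1 / ?p) * (ennreal (exit_density \<alpha> A B k x) * indicator {..a} x) \<partial>lborel)"
    using p by (intro nn_integral_cong) (auto simp: indicator_def exit_density_nonneg simp flip: ennreal_mult')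
  also have "\<dots> = ennreal (1 / ?p) * ennreal ?c"
    by (simp add: nn_integral_cmult exit_density_nn_integral)
  also have "\<dots> = ennreal (?c / ?p)"
    using p by (simp flip: ennreal_mult')
  finally show "(\<integral>\<^sup>+x. ennreal (exit_density \<alpha> A B k x / ?p * indicat_real {..a} x) \<partial>lborel) = ennreal (?c / ?p)" .
  have "{\<omega>\<in>space M. exit_state X \<omega> = k} \<inter> {\<omega>\<in>space M. exit_time X \<omega> \<le> a}
      = {\<omega>\<in>space M. exit_time X \<omega> \<le> a \<and> exit_state X \<omega> = k}" by auto
  then have "measure ?N {\<omega>\<in>space M. exit_time X \<omega> \<le> a} = ?c / ?p"
    using p by (subst measure_uniform_measure) (auto simp: emeasure_eq_measure exit_law)
  moreover have "prob_space ?N"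
    using p by (intro prob_space_uniform_measure) (auto simp: emeasure_eq_measure)
  ultimately show "emeasure ?N {\<omega>\<in>space ?N. exit_time X \<omega> \<le> a} = ennreal (?c / ?p)"
    by (simp add: finite_measure.emeasure_eq_measure[OF prob_space.axioms(1)])
next
  show "exit_time X \<in> borel_measurable ?N" by measurable
  show "(\<lambda>x. exit_density \<alpha> A B k x / ?p) \<in> borel_measurable borel" by measurable
  show "AE x in lborel. 0 \<le> exit_density \<alpha> A B k x / ?p" by (simp add: exit_density_nonneg)
qed

lemma exit_time_distributed:
  assumes "\<And>\<omega>. exit_state X \<omega> = k"
  shows "distributed M lborel (exit_time X) (\<lambda>x. ennreal (exit_density \<alpha> A B k x))"
proof (rule distributedI_borel_atMost)
  fix a :: real
  have "(\<integral>\<^sup>+x. ennreal (exit_density \<alpha> A B k x * indicat_real {..a} x) \<partial>lborel)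
      = (\<integral>\<^sup>+x. ennreal (exit_density \<alpha> A B k x) * indicator {..a} x \<partial>lborel)"
    by (intro nn_integral_cong) (simp add: indicator_def)
  then show "(\<integral>\<^sup>+x. ennreal (exit_density \<alpha> A B k x * indicat_real {..a} x) \<partial>lborel)
      = ennreal (prob {\<omega>\<in>space M. exit_time X \<omega> \<le> a \<and> exit_state X \<omega> = k})"
    by (simp add: emeasure_eq_measure flip: emeasure_exit)
  show "emeasure M {\<omega>\<in>space M. exit_time X \<omega> \<le> a}
      = ennreal (prob {\<omega>\<in>space M. exit_time X \<omega> \<le> a \<and> exit_state X \<omega> = k})"
    by (simp add: assms emeasure_eq_measure)
qed (simp_all add: exit_density_nonneg)

text \<open>A shock state of probability 0 cannot be conditioned on; the density attached to it vanishes
  almost everywhere instead.\<close>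

lemma exit_density_AE_zero:
  assumes "prob {\<omega>\<in>space M. exit_state X \<omega> = k} = 0"
  shows "AE x in lborel. exit_density \<alpha> A B k x = 0"
proof -
  have "AE x in lborel. x \<le> real n \<longrightarrow> exit_density \<alpha> A B k x = 0" for n
  proof -
    have "emeasure M {\<omega>\<in>space M. exit_time X \<omega> \<le> real n \<and> exit_state X \<omega> = k}
        \<le> emeasure M {\<omega>\<in>space M. exit_state X \<omega> = k}"
      by (intro emeasure_mono exit_state_sets) auto
    also have "\<dots> = 0" using assms by (simp add: emeasure_eq_measure)
    finally have "(\<integral>\<^sup>+x. ennreal (exit_density \<alpha> A B k x) * indicator {..real n} x \<partial>lborel) = 0"
      by (simp add: emeasure_exit)
    then have "AE x in lborel. ennreal (exit_density \<alpha> A B k x) * indicator {..real n} x = 0"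
      by (subst (asm) nn_integral_0_iff_AE) auto
    then show ?thesis
      by eventually_elim (auto simp: indicator_def ennreal_eq_0_iff exit_density_nonneg intro: antisym)
  qed
  then have "AE x in lborel. \<forall>n. x \<le> real n \<longrightarrow> exit_density \<alpha> A B k x = 0"
    by (simp only: AE_all_countable) blast
  then show ?thesis
    by eventually_elim (meson real_arch_simple)
qed

end

text \<open>Independence is postulated for the sigma-algebra generated by the path; measurability of the exit
  time with respect to that sigma-algebra transfers it to the exit time.\<close>

lemma exit_time_measurable_path_events:
  assumes rc: "\<And>\<omega>. \<omega> \<in> space M \<Longrightarrow> right_constant X \<omega>" and "S \<in> sets borel"
  shows "exit_time X -` S \<inter> space M \<in> path_events M X"
proof -
  let ?G = "{X t -` A \<inter> space M | t A. 0 \<le> t}"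
  let ?N = "sigma (space M) ?G"
  have G: "?G \<subseteq> Pow (space M)" by auto
  have "exit_time X \<in> borel_measurable ?N"
  proof (rule exit_time_measurable)
    fix t :: real assume "0 \<le> t"
    then show "X t \<in> measurable ?N (count_space UNIV)"
      using G by (intro measurableI) (auto simp: sets_measure_of intro!: sigma_sets.Basic)
  qed (use rc G in \<open>simp add: space_measure_of\<close>)
  from measurable_sets[OF this \<open>S \<in> sets borel\<close>] G show ?thesis
    by (simp add: path_events_def sets_measure_of)
qed

section \<open>The joint law of the shock time and the residual times\<close>

text \<open>\<open>shock_matrix U\<close> only sees the diagonal pairs \<open>(k, k)\<close>, because both post-shock processes start in
  the same state.\<close>

lemma shock_matrix_mult_kron_vec: "shock_matrix U *v kron_vec v w = U *v (\<chi> k. v $ k * w $ k)"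
proof -
  have "shock_matrix U $ i $ (a, b) = (if a = b then U $ i $ a else 0)" for i a b
  proof -
    have "shock_matrix U $ i $ (a, b) = (\<Sum>k\<in>UNIV. U $ i $ k * (axis k 1 $ a * axis k 1 $ b))"
      by (simp add: shock_matrix_def matrix_mult_nth columnvector_def rowvector_def kron_vec_def
          UNIV_1 matrix_vector_mult_basis column_def)
    also have "\<dots> = (\<Sum>k\<in>UNIV. if k = a then (if a = b then U $ i $ a else 0) else 0)"
      by (intro sum.cong) (auto simp: axis_def)
    finally show ?thesis by simp
  qed
  then show ?thesis
    by (simp add: vec_eq_iff matrix_vector_mult_nth sum_UNIV_prod kron_vec_def if_distrib[of "\<lambda>x. x * _"] cong: if_cong)
qed

lemma columnvector_nth: "columnvector v $ i $ j = v $ i"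
  by (simp add: columnvector_def)

lemma axis_nonneg: "0 \<le> axis k (1 :: real) $ i"
  by (simp add: axis_def)

lemma inner_eq_sum: "(x :: real ^ 'n) \<bullet> y = (\<Sum>i\<in>UNIV. x $ i * y $ i)"
  by (simp add: inner_vec_def)

lemma exit_density_exit_rates:
  "exit_density (axis k 1) Q (columnvector (exit_rates Q)) (j :: 1) t
     = (if 0 \<le> t then (matrix_exp (t *\<^sub>R Q) *v exit_rates Q) $ k else 0)"
  by (simp add: exit_density_def axis_def matrix_mult_nth matrix_vector_mult_nth columnvector_def
      if_distrib[of "\<lambda>x. x * _"] cong: if_cong)

lemma exit_density_mult_sum:
  assumes "0 \<le> t"
  shows "(\<Sum>k\<in>UNIV. exit_density \<alpha> T U k t * (v $ k * w $ k))
    = \<alpha> \<bullet> ((matrix_exp (t *\<^sub>R T) ** shock_matrix U) *v kron_vec v w)"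
proof -
  let ?E = "matrix_exp (t *\<^sub>R T)"
  have "(\<Sum>k\<in>UNIV. exit_density \<alpha> T U k t * (v $ k * w $ k))
      = (\<Sum>k\<in>UNIV. \<Sum>i\<in>UNIV. \<alpha> $ i * ((?E ** U) $ i $ k * (v $ k * w $ k)))"
    using assms by (simp add: exit_density_def sum_distrib_right mult.assoc)
  also have "\<dots> = \<alpha> \<bullet> ((?E ** U) *v (\<chi> k. v $ k * w $ k))"
    by (subst sum.swap) (simp add: inner_eq_sum matrix_vector_mult_nth sum_distrib_left)
  also have "(?E ** U) *v (\<chi> k. v $ k * w $ k) = (?E ** shock_matrix U) *v kron_vec v w"
    by (simp add: shock_matrix_mult_kron_vec flip: matrix_vector_mul_assoc)
  finally show ?thesis .
qed

text \<open>The form in which the density of the triple arises: condition on the shock state \<open>k\<close>, multiply,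
  and sum. Each factor vanishes for negative times; \<open>csph_density_eq\<close> converts the sum into matrix form.\<close>

definition csph_density ::
  "real ^ 'e \<Rightarrow> real ^ 'e ^ 'e \<Rightarrow> real ^ 's ^ 'e \<Rightarrow> real ^ 's ^ 's \<Rightarrow> real ^ 's ^ 's \<Rightarrow> real \<Rightarrow> real \<Rightarrow> real \<Rightarrow> real"
where
  "csph_density \<alpha> T U Q1 Q2 t y1 y2 =
     (\<Sum>k\<in>UNIV. exit_density \<alpha> T U k t *
        (exit_density (axis k 1) Q1 (columnvector (exit_rates Q1)) (1 :: 1) y1 *
         exit_density (axis k 1) Q2 (columnvector (exit_rates Q2)) (1 :: 1) y2))"

lemma csph_density_measurable [measurable]:
  assumes [measurable]: "f \<in> borel_measurable M" "g \<in> borel_measurable M" "h \<in> borel_measurable M"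
  shows "(\<lambda>x. csph_density \<alpha> T U Q1 Q2 (f x) (g x) (h x)) \<in> borel_measurable M"
  unfolding csph_density_def by measurable

lemma csph_density_eq:
  "csph_density \<alpha> T U Q1 Q2 t y1 y2 = (if 0 \<le> t \<and> 0 \<le> y1 \<and> 0 \<le> y2
     then \<alpha> \<bullet> ((matrix_exp (t *\<^sub>R T) ** shock_matrix U) *v
            kron_vec (matrix_exp (y1 *\<^sub>R Q1) *v exit_rates Q1) (matrix_exp (y2 *\<^sub>R Q2) *v exit_rates Q2))
     else 0)"
proof (cases "0 \<le> t \<and> 0 \<le> y1 \<and> 0 \<le> y2")
  case True
  then show ?thesis
    by (simp add: csph_density_def exit_density_exit_rates exit_density_mult_sum)
next
  case False
  then show ?thesis
    unfolding csph_density_def exit_density_exit_rates by (auto simp: exit_density_def)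
qed

lemma borel_measurable_indicator_pair:
  fixes f g :: "'c \<Rightarrow> real"
  assumes B: "B \<in> sets (lborel \<Otimes>\<^sub>M lborel)" and f: "f \<in> borel_measurable N" and g: "g \<in> borel_measurable N"
  shows "(\<lambda>x. indicator B (f x, g x) :: ennreal) \<in> borel_measurable N"
proof -
  have "(\<lambda>x. (f x, g x)) \<in> measurable N (lborel \<Otimes>\<^sub>M lborel)"
    using f g by simp
  from measurable_compose[OF this borel_measurable_indicator[OF B]] show ?thesis .
qed

lemma nn_integral_lborel_translate:
  fixes f :: "real \<Rightarrow> ennreal"
  assumes "f \<in> borel_measurable borel"
  shows "(\<integral>\<^sup>+y. f (c + y) \<partial>lborel) = (\<integral>\<^sup>+z. f z \<partial>lborel)"
  using nn_integral_real_affine[OF assms, of 1 c] by simp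

locale csph =
  fixes \<alpha> :: "real ^ 'e" and T :: "real ^ 'e ^ 'e" and U :: "real ^ 's ^ 'e"
    and Q1 Q2 :: "real ^ 's ^ 's" and a1 a2 :: real
    and M :: "'w measure" and Z :: "real \<Rightarrow> 'w \<Rightarrow> 'e + 's"
    and J1 J2 :: "real \<Rightarrow> 'w \<Rightarrow> 's + 1"
  assumes parameters: "csph_parameters \<alpha> T U Q1 Q2 a1 a2"
    and processes: "csph_processes M \<alpha> T U Q1 Q2 Z J1 J2"
begin

sublocale Z: absorbing_jump_process M \<alpha> T U Z
  using parameters processes unfolding csph_parameters_def csph_processes_def
  by unfold_locales (auto simp: inl_vec_def)

abbreviation shock :: "'s \<Rightarrow> 'w set" where
  "shock k \<equiv> {\<omega>\<in>space M. exit_state Z \<omega> = k}"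

abbreviation N :: "'s \<Rightarrow> 'w measure" where
  "N k \<equiv> uniform_measure M (shock k)"

lemma exit_rates_nonneg: "0 \<le> exit_rates Q1 $ i" "0 \<le> exit_rates Q2 $ i"
  using parameters by (auto simp: csph_parameters_def subintensity_def exit_rates_def matrix_vector_mult_nth)

lemma J1_process: "0 < Z.prob (shock k) \<Longrightarrow> absorbing_jump_process (N k) (axis k 1) Q1 (columnvector (exit_rates Q1)) J1"
  and J2_process: "0 < Z.prob (shock k) \<Longrightarrow> absorbing_jump_process (N k) (axis k 1) Q2 (columnvector (exit_rates Q2)) J2"
  using parameters processes exit_rates_nonneg
  unfolding csph_parameters_def csph_processes_def Let_def
  by (auto intro!: absorbing_jump_process.intro simp: axis_Inl columnvector_nth axis_nonneg)

text \<open>The assumptions on the post-shock processes speak about shock states of positive probability only.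
  One such state suffices to obtain the path properties of both processes and the nonnegativity of the
  exponentials of \<open>Q1\<close> and \<open>Q2\<close>.\<close>

lemma ex_shock: "\<exists>k. 0 < Z.prob (shock k)"
proof (rule ccontr)
  assume "\<not> ?thesis"
  then have "Z.prob (shock k) = 0" for k by (simp add: zero_less_measure_iff)
  then have "(\<Sum>k\<in>UNIV. Z.prob (shock k)) = 0" by simp
  moreover have "(\<Sum>k\<in>UNIV. Z.prob (shock k)) = Z.prob (\<Union>k\<in>UNIV. shock k)"
    using Z.exit_state_sets by (intro Z.finite_measure_finite_Union[symmetric]) (auto simp: disjoint_family_on_def)
  moreover have "(\<Union>k\<in>UNIV. shock k) = space M" by auto
  ultimately show False by (simp add: Z.prob_space)
qed

lemma right_constant_J: "\<omega> \<in> space M \<Longrightarrow> right_constant J1 \<omega>" "\<omega> \<in> space M \<Longrightarrow> right_constant J2 \<omega>"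
proof -
  obtain k where k: "0 < Z.prob (shock k)" using ex_shock by blast
  show "\<omega> \<in> space M \<Longrightarrow> right_constant J1 \<omega>" "\<omega> \<in> space M \<Longrightarrow> right_constant J2 \<omega>"
    using absorbing_jump_process.right_constant[OF J1_process[OF k]]
      absorbing_jump_process.right_constant[OF J2_process[OF k]] by simp_all
qed

lemma exit_time_J_measurable [measurable]:
  "exit_time J1 \<in> borel_measurable M" "exit_time J2 \<in> borel_measurable M"
  using processes right_constant_J by (auto intro!: exit_time_measurable simp: csph_processes_def)

lemma J_density_nonneg:
  "0 \<le> exit_density (axis k 1) Q1 (columnvector (exit_rates Q1)) (j :: 1) t"
  "0 \<le> exit_density (axis k 1) Q2 (columnvector (exit_rates Q2)) (j :: 1) t"
proof -
  obtain l where l: "0 < Z.prob (shock l)" using ex_shock by blast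
  show "0 \<le> exit_density (axis k 1) Q1 (columnvector (exit_rates Q1)) j t"
    "0 \<le> exit_density (axis k 1) Q2 (columnvector (exit_rates Q2)) j t"
    by (auto simp: exit_density_exit_rates matrix_vector_mult_nth
        intro!: sum_nonneg mult_nonneg_nonneg exit_rates_nonneg
          absorbing_jump_process.matrix_exp_nonneg[OF J1_process[OF l]]
          absorbing_jump_process.matrix_exp_nonneg[OF J2_process[OF l]])
qed

lemma csph_density_nonneg: "0 \<le> csph_density \<alpha> T U Q1 Q2 t y1 y2"
  unfolding csph_density_def
  by (intro sum_nonneg mult_nonneg_nonneg J_density_nonneg Z.exit_density_nonneg)

lemma J_distributed:
  assumes "0 < Z.prob (shock k)"
  shows "distributed (N k) lborel (exit_time J1) (\<lambda>y. ennreal (exit_density (axis k 1) Q1 (columnvector (exit_rates Q1)) (1 :: 1) y))"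
    "distributed (N k) lborel (exit_time J2) (\<lambda>y. ennreal (exit_density (axis k 1) Q2 (columnvector (exit_rates Q2)) (1 :: 1) y))"
proof -
  interpret J1: absorbing_jump_process "N k" "axis k 1" Q1 "columnvector (exit_rates Q1)" J1
    by (rule J1_process[OF assms])
  interpret J2: absorbing_jump_process "N k" "axis k 1" Q2 "columnvector (exit_rates Q2)" J2
    by (rule J2_process[OF assms])
  show "distributed (N k) lborel (exit_time J1) (\<lambda>y. ennreal (exit_density (axis k 1) Q1 (columnvector (exit_rates Q1)) (1 :: 1) y))"
    by (rule J1.exit_time_distributed[OF num1_eq1])
  show "distributed (N k) lborel (exit_time J2) (\<lambda>y. ennreal (exit_density (axis k 1) Q2 (columnvector (exit_rates Q2)) (1 :: 1) y))"
    by (rule J2.exit_time_distributed[OF num1_eq1])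
qed

lemma distributed_given_shock:
  assumes p: "0 < Z.prob (shock k)"
  shows "distributed (N k) (lborel \<Otimes>\<^sub>M lborel \<Otimes>\<^sub>M lborel) (\<lambda>\<omega>. (exit_time Z \<omega>, exit_time J1 \<omega>, exit_time J2 \<omega>))
    (\<lambda>(t, y). ennreal (exit_density \<alpha> T U k t / Z.prob (shock k)) *
       (case y of (y1, y2) \<Rightarrow> ennreal (exit_density (axis k 1) Q1 (columnvector (exit_rates Q1)) (1 :: 1) y1) *
         ennreal (exit_density (axis k 1) Q2 (columnvector (exit_rates Q2)) (1 :: 1) y2)))"
proof -
  interpret N: prob_space "N k"
    using p by (intro prob_space_uniform_measure) (auto simp: Z.emeasure_eq_measure)
  let ?X = "\<lambda>i::nat. [exit_time Z, exit_time J1, exit_time J2] ! i"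
  let ?F = "\<lambda>i::nat. [sets (vimage_algebra (space M) (exit_time Z) borel), path_events M J1, path_events M J2] ! i"
  have "N.indep_sets ?F {..<3}"
    using processes p by (simp add: csph_processes_def Let_def)
  then have "N.indep_sets (\<lambda>i. {?X i -` A \<inter> space (N k) | A. A \<in> sets borel}) {..<3}"
  proof (rule N.indep_sets_mono_sets)
    fix i :: nat assume "i \<in> {..<3}"
    then consider "i = 0" | "i = 1" | "i = 2" by fastforce
    then show "{?X i -` A \<inter> space (N k) | A. A \<in> sets borel} \<subseteq> ?F i"
      by cases (auto intro: in_vimage_algebra exit_time_measurable_path_events right_constant_J)
  qed
  moreover have "?X i \<in> borel_measurable (N k)" if "i \<in> {..<3}" for i
  proof -
    from that consider "i = 0" | "i = 1" | "i = 2" by fastforce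
    then show ?thesis by cases simp_all
  qed
  ultimately have vars: "N.indep_vars (\<lambda>_. borel) ?X {..<3}"
    unfolding N.indep_vars_def2 by simp
  have JJ: "N.indep_var lborel (exit_time J1) lborel (exit_time J2)"
    using N.indep_var_compose[OF N.indep_var_restrict[OF vars, of "{1}" "{2}"],
        of "\<lambda>f. f 1" lborel "\<lambda>f. f 2" lborel]
    by (simp add: o_def)
  let ?J = "\<lambda>\<omega>. (exit_time J1 \<omega>, exit_time J2 \<omega>)"
  \<comment> \<open>\<open>indep_var\<close> relates variables with values in one common type, so the real exit time is padded with 0.\<close>
  have ZJ: "N.indep_var (lborel \<Otimes>\<^sub>M lborel) (\<lambda>\<omega>. (exit_time Z \<omega>, 0 :: real)) (lborel \<Otimes>\<^sub>M lborel) ?J"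
    using N.indep_var_compose[OF N.indep_var_restrict[OF vars, of "{0}" "{1, 2}"],
        of "\<lambda>f. (f 0, 0)" "lborel \<Otimes>\<^sub>M lborel" "\<lambda>f. (f 1, f 2)" "lborel \<Otimes>\<^sub>M lborel"]
    by (simp add: o_def)
  have "distr (N k) lborel (exit_time Z) \<Otimes>\<^sub>M distr (N k) (lborel \<Otimes>\<^sub>M lborel) ?J
      = distr (N k) (lborel \<Otimes>\<^sub>M lborel \<Otimes>\<^sub>M lborel) (\<lambda>\<omega>. (exit_time Z \<omega>, ?J \<omega>))"
  proof (rule pair_measure_eqI)
    show "sigma_finite_measure (distr (N k) lborel (exit_time Z))"
      by (intro finite_measure.axioms(1) N.finite_measure_distr) simp
    show "sigma_finite_measure (distr (N k) (lborel \<Otimes>\<^sub>M lborel) ?J)"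
      by (intro finite_measure.axioms(1) N.finite_measure_distr) simp
    fix A B assume "A \<in> sets (distr (N k) lborel (exit_time Z))" "B \<in> sets (distr (N k) (lborel \<Otimes>\<^sub>M lborel) ?J)"
    then have AB [measurable]: "A \<in> sets lborel" "B \<in> sets (lborel \<Otimes>\<^sub>M lborel)" by (simp_all only: sets_distr)
    have AB': "A \<times> B \<in> sets (lborel \<Otimes>\<^sub>M lborel \<Otimes>\<^sub>M lborel)" by measurable
    have "N.prob ((\<lambda>\<omega>. ((exit_time Z \<omega>, 0 :: real), ?J \<omega>)) -` ((A \<times> UNIV) \<times> B) \<inter> space (N k))
        = N.prob ((\<lambda>\<omega>. (exit_time Z \<omega>, 0 :: real)) -` (A \<times> UNIV) \<inter> space (N k)) * N.prob (?J -` B \<inter> space (N k))"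
      by (intro N.indep_varD[OF ZJ]) measurable
    moreover have "(\<lambda>\<omega>. ((exit_time Z \<omega>, 0 :: real), ?J \<omega>)) -` ((A \<times> UNIV) \<times> B)
        = (\<lambda>\<omega>. (exit_time Z \<omega>, ?J \<omega>)) -` (A \<times> B)"
      and "(\<lambda>\<omega>. (exit_time Z \<omega>, 0 :: real)) -` (A \<times> UNIV) = exit_time Z -` A" by auto
    ultimately show "emeasure (distr (N k) lborel (exit_time Z)) A * emeasure (distr (N k) (lborel \<Otimes>\<^sub>M lborel) ?J) B
        = emeasure (distr (N k) (lborel \<Otimes>\<^sub>M lborel \<Otimes>\<^sub>M lborel) (\<lambda>\<omega>. (exit_time Z \<omega>, ?J \<omega>))) (A \<times> B)"
      using AB AB' by (subst (1 2 3) emeasure_distr) (simp_all add: N.emeasure_eq_measure flip: ennreal_mult')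
  qed simp
  then show ?thesis
    by (intro N.distributed_joint_indep'[OF _ _ Z.exit_time_distributed_conditionally[OF p]
          N.distributed_joint_indep[OF _ _ J_distributed[OF p] JJ]]
        sigma_finite_pair_measure sigma_finite_lborel)
qed

lemma emeasure_triple_shock:
  assumes B: "B \<in> sets (lborel \<Otimes>\<^sub>M lborel \<Otimes>\<^sub>M lborel)"
  shows "emeasure M {\<omega>\<in>space M. (exit_time Z \<omega>, exit_time J1 \<omega>, exit_time J2 \<omega>) \<in> B \<and> exit_state Z \<omega> = k}
    = (\<integral>\<^sup>+(t, y1, y2). ennreal (exit_density \<alpha> T U k t *
        (exit_density (axis k 1) Q1 (columnvector (exit_rates Q1)) (1 :: 1) y1 *
         exit_density (axis k 1) Q2 (columnvector (exit_rates Q2)) (1 :: 1) y2)) * indicator B (t, y1, y2)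
       \<partial>(lborel \<Otimes>\<^sub>M lborel \<Otimes>\<^sub>M lborel))"
    (is "emeasure M ?A = (\<integral>\<^sup>+(t, y1, y2). ennreal (?g t * (?h1 y1 * ?h2 y2)) * _ \<partial>?L)")
proof (cases "0 < Z.prob (shock k)")
  case True
  let ?p = "Z.prob (shock k)"
  let ?X = "\<lambda>\<omega>. (exit_time Z \<omega>, exit_time J1 \<omega>, exit_time J2 \<omega>)"
  note [measurable] = B Z.exit_state_sets
  have X [measurable]: "?X \<in> measurable M ?L" by measurable
  have "{\<omega>\<in>space M. ?X \<omega> \<in> B} \<in> sets M" by measurable
  moreover have "?A = shock k \<inter> {\<omega>\<in>space M. ?X \<omega> \<in> B}" by auto
  ultimately have "emeasure (N k) {\<omega>\<in>space M. ?X \<omega> \<in> B} = emeasure M ?A / ennreal ?p"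
    by (simp add: Z.emeasure_eq_measure Z.exit_state_sets)
  then have "emeasure M ?A = ennreal ?p * emeasure (N k) {\<omega>\<in>space M. ?X \<omega> \<in> B}"
    using True by (simp add: ennreal_times_divide mult.commute[of "ennreal ?p"] ennreal_mult_divide_eq)
  also have "{\<omega>\<in>space M. ?X \<omega> \<in> B} = ?X -` B \<inter> space (N k)" by auto
  also have "emeasure (N k) (?X -` B \<inter> space (N k)) = (\<integral>\<^sup>+x. (case x of (t, y) \<Rightarrow> ennreal (?g t / ?p) *
      (case y of (y1, y2) \<Rightarrow> ennreal (?h1 y1) * ennreal (?h2 y2))) * indicator B x \<partial>?L)"
    by (rule distributed_emeasure[OF distributed_given_shock[OF True] B])
  also have "ennreal ?p * \<dots> = (\<integral>\<^sup>+x. ennreal ?p * ((case x of (t, y) \<Rightarrow> ennreal (?g t / ?p) *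
      (case y of (y1, y2) \<Rightarrow> ennreal (?h1 y1) * ennreal (?h2 y2))) * indicator B x) \<partial>?L)"
    by (intro nn_integral_cmult[symmetric]) measurable
  also have "\<dots> = (\<integral>\<^sup>+(t, y1, y2). ennreal (?g t * (?h1 y1 * ?h2 y2)) * indicator B (t, y1, y2) \<partial>?L)"
    using True
    by (intro nn_integral_cong)
      (auto simp: J_density_nonneg Z.exit_density_nonneg indicator_def split: prod.split simp flip: ennreal_mult')
  finally show ?thesis .
next
  case False
  then have p0: "Z.prob (shock k) = 0" by (simp add: zero_less_measure_iff)
  note [measurable] = B
  have "emeasure M ?A \<le> emeasure M (shock k)"
    by (intro emeasure_mono Z.exit_state_sets) auto
  also have "\<dots> = 0" using p0 by (simp add: Z.emeasure_eq_measure)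
  finally have "emeasure M ?A = 0" by simp
  moreover have "(\<integral>\<^sup>+(t, y1, y2). ennreal (?g t * (?h1 y1 * ?h2 y2)) * indicator B (t, y1, y2) \<partial>?L)
      = (\<integral>\<^sup>+t. \<integral>\<^sup>+y. (case y of (y1, y2) \<Rightarrow> ennreal (?g t * (?h1 y1 * ?h2 y2)) * indicator B (t, y1, y2)) \<partial>(lborel \<Otimes>\<^sub>M lborel) \<partial>lborel)"
    by (subst sigma_finite_measure.nn_integral_fst[symmetric])
      (auto intro: sigma_finite_pair_measure sigma_finite_lborel)
  moreover have "\<dots> = (\<integral>\<^sup>+t. 0 \<partial>(lborel :: real measure))"
  proof (rule nn_integral_cong_AE)
    show "AE t in lborel. (\<integral>\<^sup>+y. (case y of (y1, y2) \<Rightarrow> ennreal (?g t * (?h1 y1 * ?h2 y2)) * indicator B (t, y1, y2)) \<partial>(lborel \<Otimes>\<^sub>M lborel)) = 0"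
      using Z.exit_density_AE_zero[OF p0]
      by eventually_elim (simp add: case_prod_beta')
  qed
  ultimately show ?thesis by simp
qed

lemma triple_distributed:
  "distributed M (lborel \<Otimes>\<^sub>M lborel \<Otimes>\<^sub>M lborel) (\<lambda>\<omega>. (exit_time Z \<omega>, exit_time J1 \<omega>, exit_time J2 \<omega>))
     (\<lambda>(t, y1, y2). ennreal (csph_density \<alpha> T U Q1 Q2 t y1 y2))"
    (is "distributed M ?L ?X ?f")
  unfolding distributed_def
proof (intro conjI measure_eqI)
  show X [measurable]: "?X \<in> measurable M ?L" by measurable
  show f [measurable]: "?f \<in> borel_measurable ?L" by measurable
  fix B assume "B \<in> sets (distr M ?L ?X)"
  then have B [measurable]: "B \<in> sets ?L" by (simp only: sets_distr)
  have sets: "{\<omega>\<in>space M. ?X \<omega> \<in> B \<and> exit_state Z \<omega> = k} \<in> sets M" for k by measurable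
  have "emeasure (distr M ?L ?X) B = emeasure M (\<Union>k\<in>UNIV. {\<omega>\<in>space M. ?X \<omega> \<in> B \<and> exit_state Z \<omega> = k})"
    using B by (subst emeasure_distr) (auto intro!: arg_cong[where f = "emeasure M"])
  also have "\<dots> = (\<Sum>k\<in>UNIV. emeasure M {\<omega>\<in>space M. ?X \<omega> \<in> B \<and> exit_state Z \<omega> = k})"
    using sets by (intro sum_emeasure[symmetric]) (auto simp: disjoint_family_on_def)
  also have "\<dots> = (\<integral>\<^sup>+x. (\<Sum>k\<in>UNIV. case x of (t, y1, y2) \<Rightarrow> ennreal (exit_density \<alpha> T U k t *
        (exit_density (axis k 1) Q1 (columnvector (exit_rates Q1)) (1 :: 1) y1 *
         exit_density (axis k 1) Q2 (columnvector (exit_rates Q2)) (1 :: 1) y2)) * indicator B (t, y1, y2)) \<partial>?L)"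
    unfolding emeasure_triple_shock[OF B] by (intro nn_integral_sum[symmetric]) measurable
  also have "\<dots> = (\<integral>\<^sup>+x. ?f x * indicator B x \<partial>?L)"
    by (intro nn_integral_cong)
      (auto simp: csph_density_def J_density_nonneg Z.exit_density_nonneg sum_ennreal simp flip: sum_distrib_right)
  also have "\<dots> = emeasure (density ?L ?f) B"
    by (rule emeasure_density[OF f B, symmetric])
  finally show "emeasure (distr M ?L ?X) B = emeasure (density ?L ?f) B" .
qed simp

section \<open>The law of the weighted sums\<close>

text \<open>The shock can have happened at time \<open>t\<close> only if both residual times \<open>z1 - a1 t\<close> and \<open>z2 - a2 t\<close> are
  nonnegative, that is \<open>t \<le> m\<close>. On \<open>[0, m]\<close> both post-shock exponentials factor through
  \<open>exp(C (m - t))\<close>, which makes Duhamel's formula applicable.\<close>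

lemma integral_csph_density_eq_V_block:
  assumes "0 \<le> z1" "0 \<le> z2"
  defines "m \<equiv> min (z1 / a1) (z2 / a2)"
  defines "c \<equiv> \<alpha> \<bullet> (V_block T (shock_matrix U) (kron_sum (a1 *\<^sub>R Q1) (a2 *\<^sub>R Q2)) m *v
     kron_vec (matrix_exp ((z1 - a1 * m) *\<^sub>R Q1) *v exit_rates Q1)
              (matrix_exp ((z2 - a2 * m) *\<^sub>R Q2) *v exit_rates Q2))"
  shows "0 \<le> c"
    and "(\<integral>\<^sup>+t. ennreal (csph_density \<alpha> T U Q1 Q2 t (z1 - a1 * t) (z2 - a2 * t)) \<partial>lborel) = ennreal c"
proof -
  let ?C = "kron_sum (a1 *\<^sub>R Q1) (a2 *\<^sub>R Q2)"
  let ?w = "kron_vec (matrix_exp ((z1 - a1 * m) *\<^sub>R Q1) *v exit_rates Q1)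
              (matrix_exp ((z2 - a2 * m) *\<^sub>R Q2) *v exit_rates Q2)"
  let ?f = "\<lambda>t. csph_density \<alpha> T U Q1 Q2 t (z1 - a1 * t) (z2 - a2 * t)"
  define \<Phi> where "\<Phi> s = \<alpha> \<bullet> ((V_block T (shock_matrix U) ?C s ** matrix_exp ((m - s) *\<^sub>R ?C)) *v ?w)" for s
  have a: "0 < a1" "0 < a2" using parameters by (auto simp: csph_parameters_def)
  have m: "0 \<le> m" using assms(1,2) a by (simp add: m_def)
  have le_m: "t \<le> m \<longleftrightarrow> 0 \<le> z1 - a1 * t \<and> 0 \<le> z2 - a2 * t" for t
    using a by (auto simp: m_def field_simps)
  \<comment> \<open>Uses \<open>z - b s = b (m - s) + (z - b m)\<close> in either component.\<close>
  have exp_w: "matrix_exp ((m - s) *\<^sub>R ?C) *v ?w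
      = kron_vec (matrix_exp ((z1 - a1 * s) *\<^sub>R Q1) *v exit_rates Q1)
                 (matrix_exp ((z2 - a2 * s) *\<^sub>R Q2) *v exit_rates Q2)" for s
  proof -
    have "matrix_exp ((z - b * s) *\<^sub>R Q) *v q
        = matrix_exp ((m - s) *\<^sub>R (b *\<^sub>R Q)) *v (matrix_exp ((z - b * m) *\<^sub>R Q) *v q)"
      for z b and Q :: "real ^ 's ^ 's" and q
      using matrix_exp_add_mult_vec[of "(m - s) * b" "z - b * m" Q q] by (simp add: algebra_simps)
    then show ?thesis by (simp add: matrix_exp_kron_sum)
  qed
  have f_eq: "?f s = \<alpha> \<bullet> ((matrix_exp (s *\<^sub>R T) ** shock_matrix U ** matrix_exp ((m - s) *\<^sub>R ?C)) *v ?w)"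
    if "s \<in> {0..m}" for s
    using that le_m[of s] by (simp add: csph_density_eq exp_w flip: matrix_vector_mul_assoc)
  have D: "(\<Phi> has_real_derivative ?f s) (at s)" if "s \<in> {0..m}" for s
    unfolding has_real_derivative_iff_has_vector_derivative f_eq[OF that] \<Phi>_def
    by (intro bounded_linear.has_vector_derivative[OF bounded_linear_inner_right]
        bounded_linear.has_vector_derivative[OF bounded_bilinear.bounded_linear_left[OF bounded_bilinear_matrix_vector_mult]]
        V_block_duhamel_has_vector_derivative)
  have "\<Phi> 0 \<le> \<Phi> m"
  proof (rule DERIV_nonneg_imp_nondecreasing[OF m])
    fix x assume "0 \<le> x" "x \<le> m"
    then have "(\<Phi> has_real_derivative ?f x) (at x)" by (intro D) simp
    with csph_density_nonneg show "\<exists>y. (\<Phi> has_real_derivative y) (at x) \<and> 0 \<le> y" by blast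
  qed
  moreover have \<Phi>0: "\<Phi> 0 = 0"
    by (simp add: \<Phi>_def bounded_bilinear.zero_left[OF bounded_bilinear_matrix_matrix_mult]
        bounded_bilinear.zero_left[OF bounded_bilinear_matrix_vector_mult])
  moreover have \<Phi>m: "\<Phi> m = c" by (simp add: \<Phi>_def c_def)
  ultimately show "0 \<le> c" by simp
  have "(\<integral>\<^sup>+t. ennreal (?f t) \<partial>lborel) = (\<integral>\<^sup>+t. ennreal (?f t) * indicator {0..m} t \<partial>lborel)"
    using le_m by (intro nn_integral_cong) (auto simp: csph_density_eq indicator_def)
  also have "\<dots> = \<Phi> m - \<Phi> 0"
    by (intro nn_integral_FTC_Icc D csph_density_nonneg m) measurable
  finally show "(\<integral>\<^sup>+t. ennreal (?f t) \<partial>lborel) = ennreal c"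
    by (simp add: \<Phi>0 \<Phi>m)
qed

lemma integral_csph_density:
  shows "(\<integral>\<^sup>+t. ennreal (csph_density \<alpha> T U Q1 Q2 t (z1 - a1 * t) (z2 - a2 * t)) \<partial>lborel)
     = ennreal (if 0 \<le> z1 \<and> 0 \<le> z2
          then (let m = min (z1 / a1) (z2 / a2) in
                    \<alpha> \<bullet> (V_block T (shock_matrix U) (kron_sum (a1 *\<^sub>R Q1) (a2 *\<^sub>R Q2)) m *v
                        kron_vec (matrix_exp ((z1 - a1 * m) *\<^sub>R Q1) *v exit_rates Q1)
                                 (matrix_exp ((z2 - a2 * m) *\<^sub>R Q2) *v exit_rates Q2)))
          else 0)"
proof (cases "0 \<le> z1 \<and> 0 \<le> z2")
  case True
  then show ?thesis by (simp add: integral_csph_density_eq_V_block Let_def)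
next
  case False
  have "csph_density \<alpha> T U Q1 Q2 t (z1 - a1 * t) (z2 - a2 * t) = 0" for t
  proof (cases "0 \<le> t")
    case True
    moreover have "0 < a1" "0 < a2" using parameters by (auto simp: csph_parameters_def)
    ultimately have "0 \<le> a1 * t" "0 \<le> a2 * t" by simp_all
    with False show ?thesis by (auto simp: csph_density_eq)
  qed (simp add: csph_density_eq)
  with False show ?thesis by auto
qed

text \<open>For a fixed shock time the weighted sums are translates of the residual times. Translation
  invariance of Lebesgue measure and Tonelli's theorem move the integration over the shock time inside.\<close>

lemma emeasure_weighted_sums:
  assumes B: "B \<in> sets (lborel \<Otimes>\<^sub>M lborel)"
  shows "emeasure M ((\<lambda>\<omega>. (a1 * exit_time Z \<omega> + exit_time J1 \<omega>, a2 * exit_time Z \<omega> + exit_time J2 \<omega>)) -` B \<inter> space M)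
    = (\<integral>\<^sup>+(z1, z2). (\<integral>\<^sup>+t. ennreal (csph_density \<alpha> T U Q1 Q2 t (z1 - a1 * t) (z2 - a2 * t)) \<partial>lborel) * indicator B (z1, z2)
        \<partial>(lborel \<Otimes>\<^sub>M lborel))"
proof -
  let ?L = "lborel \<Otimes>\<^sub>M lborel \<Otimes>\<^sub>M lborel :: (real \<times> real \<times> real) measure"
  let ?g = "csph_density \<alpha> T U Q1 Q2"
  let ?X = "\<lambda>\<omega>. (exit_time Z \<omega>, exit_time J1 \<omega>, exit_time J2 \<omega>)"
  let ?S = "\<lambda>(t, y1, y2). (a1 * t + y1, a2 * t + y2)"
  note [measurable] = B borel_measurable_indicator_pair[OF B]
  interpret P: pair_sigma_finite lborel "lborel \<Otimes>\<^sub>M lborel :: (real \<times> real) measure"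
    by (intro pair_sigma_finite.intro sigma_finite_pair_measure sigma_finite_lborel)
  have S: "?S \<in> measurable ?L (lborel \<Otimes>\<^sub>M lborel)" by measurable
  then have SB: "?S -` B \<in> sets ?L"
    using measurable_sets[OF S B] by (simp add: space_pair_measure)
  have "(\<lambda>\<omega>. (a1 * exit_time Z \<omega> + exit_time J1 \<omega>, a2 * exit_time Z \<omega> + exit_time J2 \<omega>)) -` B = ?X -` (?S -` B)"
    by auto
  then have "emeasure M ((\<lambda>\<omega>. (a1 * exit_time Z \<omega> + exit_time J1 \<omega>, a2 * exit_time Z \<omega> + exit_time J2 \<omega>)) -` B \<inter> space M)
      = (\<integral>\<^sup>+x. (case x of (t, y1, y2) \<Rightarrow> ennreal (?g t y1 y2)) * indicator (?S -` B) x \<partial>?L)"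
    by (simp only: distributed_emeasure[OF triple_distributed SB])
  also have "\<dots> = (\<integral>\<^sup>+x. (case x of (t, y1, y2) \<Rightarrow> ennreal (?g t y1 y2) * indicator B (a1 * t + y1, a2 * t + y2)) \<partial>?L)"
    by (intro nn_integral_cong) (auto simp: indicator_def)
  also have "\<dots> = (\<integral>\<^sup>+t. \<integral>\<^sup>+y. (case y of (y1, y2) \<Rightarrow> ennreal (?g t y1 y2) * indicator B (a1 * t + y1, a2 * t + y2))
      \<partial>(lborel \<Otimes>\<^sub>M lborel) \<partial>lborel)"
    by (subst sigma_finite_measure.nn_integral_fst[symmetric])
      (measurable, auto intro: sigma_finite_pair_measure sigma_finite_lborel)
  also have "\<dots> = (\<integral>\<^sup>+t. \<integral>\<^sup>+y1. \<integral>\<^sup>+y2. ennreal (?g t y1 y2) * indicator B (a1 * t + y1, a2 * t + y2) \<partial>lborel \<partial>lborel \<partial>lborel)"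
  proof (rule nn_integral_cong)
    fix t :: real
    have "(\<lambda>y. case y of (y1, y2) \<Rightarrow> ennreal (?g t y1 y2) * indicator B (a1 * t + y1, a2 * t + y2))
        \<in> borel_measurable (lborel \<Otimes>\<^sub>M lborel)" by measurable
    from lborel.nn_integral_fst[OF this]
    show "(\<integral>\<^sup>+y. (case y of (y1, y2) \<Rightarrow> ennreal (?g t y1 y2) * indicator B (a1 * t + y1, a2 * t + y2)) \<partial>(lborel \<Otimes>\<^sub>M lborel))
        = (\<integral>\<^sup>+y1. \<integral>\<^sup>+y2. ennreal (?g t y1 y2) * indicator B (a1 * t + y1, a2 * t + y2) \<partial>lborel \<partial>lborel)"
      by simp
  qed
  also have "\<dots> = (\<integral>\<^sup>+t. \<integral>\<^sup>+y1. \<integral>\<^sup>+z2. ennreal (?g t y1 (z2 - a2 * t)) * indicator B (a1 * t + y1, z2) \<partial>lborel \<partial>lborel \<partial>lborel)"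
  proof (rule nn_integral_cong, rule nn_integral_cong)
    fix t y1 :: real
    show "(\<integral>\<^sup>+y2. ennreal (?g t y1 y2) * indicator B (a1 * t + y1, a2 * t + y2) \<partial>lborel)
        = (\<integral>\<^sup>+z2. ennreal (?g t y1 (z2 - a2 * t)) * indicator B (a1 * t + y1, z2) \<partial>lborel)"
      using nn_integral_lborel_translate[of "\<lambda>z2. ennreal (?g t y1 (z2 - a2 * t)) * indicator B (a1 * t + y1, z2)" "a2 * t"]
      by simp
  qed
  also have "\<dots> = (\<integral>\<^sup>+t. \<integral>\<^sup>+z1. \<integral>\<^sup>+z2. ennreal (?g t (z1 - a1 * t) (z2 - a2 * t)) * indicator B (z1, z2) \<partial>lborel \<partial>lborel \<partial>lborel)"
  proof (rule nn_integral_cong)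
    fix t :: real
    show "(\<integral>\<^sup>+y1. \<integral>\<^sup>+z2. ennreal (?g t y1 (z2 - a2 * t)) * indicator B (a1 * t + y1, z2) \<partial>lborel \<partial>lborel)
        = (\<integral>\<^sup>+z1. \<integral>\<^sup>+z2. ennreal (?g t (z1 - a1 * t) (z2 - a2 * t)) * indicator B (z1, z2) \<partial>lborel \<partial>lborel)"
      using nn_integral_lborel_translate[of
          "\<lambda>z1. \<integral>\<^sup>+z2. ennreal (?g t (z1 - a1 * t) (z2 - a2 * t)) * indicator B (z1, z2) \<partial>lborel" "a1 * t"]
      by simp
  qed
  also have "\<dots> = (\<integral>\<^sup>+t. \<integral>\<^sup>+z. (case z of (z1, z2) \<Rightarrow> ennreal (?g t (z1 - a1 * t) (z2 - a2 * t)) * indicator B (z1, z2))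
      \<partial>(lborel \<Otimes>\<^sub>M lborel) \<partial>lborel)"
  proof (rule nn_integral_cong)
    fix t :: real
    have "(\<lambda>z. case z of (z1, z2) \<Rightarrow> ennreal (?g t (z1 - a1 * t) (z2 - a2 * t)) * indicator B (z1, z2))
        \<in> borel_measurable (lborel \<Otimes>\<^sub>M lborel)" by measurable
    from lborel.nn_integral_fst[OF this]
    show "(\<integral>\<^sup>+z1. \<integral>\<^sup>+z2. ennreal (?g t (z1 - a1 * t) (z2 - a2 * t)) * indicator B (z1, z2) \<partial>lborel \<partial>lborel)
        = (\<integral>\<^sup>+z. (case z of (z1, z2) \<Rightarrow> ennreal (?g t (z1 - a1 * t) (z2 - a2 * t)) * indicator B (z1, z2)) \<partial>(lborel \<Otimes>\<^sub>M lborel))"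
      by simp
  qed
  also have "\<dots> = (\<integral>\<^sup>+z. \<integral>\<^sup>+t. (case z of (z1, z2) \<Rightarrow> ennreal (?g t (z1 - a1 * t) (z2 - a2 * t)) * indicator B (z1, z2))
      \<partial>lborel \<partial>(lborel \<Otimes>\<^sub>M lborel))"
    by (intro P.Fubini'[symmetric]) measurable
  also have "\<dots> = (\<integral>\<^sup>+(z1, z2). (\<integral>\<^sup>+t. ennreal (?g t (z1 - a1 * t) (z2 - a2 * t)) \<partial>lborel) * indicator B (z1, z2)
      \<partial>(lborel \<Otimes>\<^sub>M lborel))"
    by (intro nn_integral_cong) (auto simp: nn_integral_multc)
  finally show ?thesis .
qed

lemma weighted_sums_distributed:
  "distributed M (lborel \<Otimes>\<^sub>M lborel) (\<lambda>\<omega>. (a1 * exit_time Z \<omega> + exit_time J1 \<omega>, a2 * exit_time Z \<omega> + exit_time J2 \<omega>))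
    (\<lambda>(z1, z2). \<integral>\<^sup>+t. ennreal (csph_density \<alpha> T U Q1 Q2 t (z1 - a1 * t) (z2 - a2 * t)) \<partial>lborel)"
    (is "distributed M ?L ?X ?f")
  unfolding distributed_def
proof (intro conjI measure_eqI)
  show X [measurable]: "?X \<in> measurable M ?L" by measurable
  show f [measurable]: "?f \<in> borel_measurable ?L" by measurable
  fix B assume "B \<in> sets (distr M ?L ?X)"
  then have B: "B \<in> sets ?L" by (simp only: sets_distr)
  have "emeasure (distr M ?L ?X) B = (\<integral>\<^sup>+z. ?f z * indicator B z \<partial>?L)"
    unfolding emeasure_distr[OF X B] emeasure_weighted_sums[OF B] by (simp add: case_prod_beta')
  then show "emeasure (distr M ?L ?X) B = emeasure (density ?L ?f) B"
    unfolding emeasure_density[OF f B] .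
qed simp

end

theorem theorem4p1:
  fixes \<alpha> :: "real ^ 'e" and T :: "real ^ 'e ^ 'e" and U :: "real ^ 's ^ 'e"
    and Q1 Q2 :: "real ^ 's ^ 's" and a1 a2 :: real
    and M :: "'w measure" and Z :: "real \<Rightarrow> 'w \<Rightarrow> 'e + 's"
    and J1 J2 :: "real \<Rightarrow> 'w \<Rightarrow> 's + 1"
    and \<tau> \<tau>1 \<tau>2 X1 X2 :: "'w \<Rightarrow> real"
  assumes "csph_parameters \<alpha> T U Q1 Q2 a1 a2"
    and "csph_processes M \<alpha> T U Q1 Q2 Z J1 J2"
    and "\<tau> = exit_time Z" and "\<tau>1 = exit_time J1" and "\<tau>2 = exit_time J2"
    and "X1 = (\<lambda>\<omega>. a1 * \<tau> \<omega> + \<tau>1 \<omega>)" and "X2 = (\<lambda>\<omega>. a2 * \<tau> \<omega> + \<tau>2 \<omega>)"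
  shows "has_density M (lborel \<Otimes>\<^sub>M lborel \<Otimes>\<^sub>M lborel) (\<lambda>\<omega>. (\<tau> \<omega>, \<tau>1 \<omega>, \<tau>2 \<omega>))
           (\<lambda>(t, y1, y2). if 0 \<le> t \<and> 0 \<le> y1 \<and> 0 \<le> y2
              then \<alpha> \<bullet> ((matrix_exp (t *\<^sub>R T) ** shock_matrix U) *v
                        kron_vec (matrix_exp (y1 *\<^sub>R Q1) *v exit_rates Q1)
                                 (matrix_exp (y2 *\<^sub>R Q2) *v exit_rates Q2))
              else 0) \<and>
         has_density M (lborel \<Otimes>\<^sub>M lborel) (\<lambda>\<omega>. (X1 \<omega>, X2 \<omega>))
           (\<lambda>(z1, z2). if 0 \<le> z1 \<and> 0 \<le> z2
              then (let m = min (z1 / a1) (z2 / a2) in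
                    \<alpha> \<bullet> (V_block T (shock_matrix U) (kron_sum (a1 *\<^sub>R Q1) (a2 *\<^sub>R Q2)) m *v
                        kron_vec (matrix_exp ((z1 - a1 * m) *\<^sub>R Q1) *v exit_rates Q1)
                                 (matrix_exp ((z2 - a2 * m) *\<^sub>R Q2) *v exit_rates Q2)))
              else 0)"
proof -
  interpret csph \<alpha> T U Q1 Q2 a1 a2 M Z J1 J2
    by (rule csph.intro) (rule assms)+
  show ?thesis
    unfolding has_density_def assms(3-7)
    using triple_distributed weighted_sums_distributed csph_density_nonneg integral_csph_density_eq_V_block(1)
    by (simp add: csph_density_eq[symmetric] integral_csph_density case_prod_beta' Let_def)
qed

end
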